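(* Let $G$ be a totally disconnected, locally compact group, let $H$ be a closed subgroup of $G$ and let $K$ be a subgroup of $H$. Suppose that $\overline{K}$ is either cocompact in $H$ or of finite covolume in $H$ (or both). Then for all $h \in H$, there exist $k \in K$ and $t \in G^\dagger_k$ such that $\mathrm{con}(h) = t\,\mathrm{con}(k)\,t^{-1}$. As a consequence, \[ \{G^\dagger_h \mid h \in H\} = \{G^\dagger_k \mid k \in K\}, \] and hence $G^\dagger_H = G^\dagger_K$.
   Context: Topological groups are Hausdorff. For $g \in G$, $\mathrm{con}(g) = \{x \in G \mid g^n x g^{-n} \to 1 \text{ as } n \to +\infty\}$ (computed in $G$). For a subset $X \subseteq G$, the relative Tits core is the abstract subgroup $G^\dagger_X := \langle \overline{\mathrm{con}(x)} \mid x \in X \cup X^{-1}\rangle$, and $G^\dagger_x := G^\dagger_{\{x\}}$. A closed subgroup $L$ of $H$ is cocompact in $H$ if $H/L$ is compact, and of finite covolume in $H$ if $H/L$ carries an $H$-invariant Borel probability measure.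
   Formalization: In "finite covolume", the H-invariant Borel probability measure on H/L is also required to be tight (compact sets of measure arbitrarily close to 1); this is automatic for σ-compact H, and without it the claim fails if a measurable cardinal exists. *)

theory Defs
  imports
    "HOL-Algebra.Coset"
    "HOL-Algebra.Generated_Groups"
    "HOL-Analysis.Abstract_Topological_Spaces"
    "HOL-Probability.Probability_Measure"
begin

locale topological_group = group G for G (structure) +
  fixes T :: "'a topology"
  assumes topspace_eq: "topspace T = carrier G"
    and Hausdorff: "Hausdorff_space T"
    and continuous_mult: "continuous_map (prod_topology T T) T (\<lambda>(x, y). x \<otimes> y)"
    and continuous_inv: "continuous_map T T (\<lambda>x. inv x)"

definition totally_disconnected_space :: "'a topology \<Rightarrow> bool" where
  "totally_disconnected_space T \<longleftrightarrow>
     (\<forall>x \<in> topspace T. connected_component_of_set T x = {x})"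

definition con :: "('a, 'b) monoid_scheme \<Rightarrow> 'a topology \<Rightarrow> 'a \<Rightarrow> 'a set" where
  "con G T g = {x \<in> carrier G.
     limitin T (\<lambda>n::nat. g [^]\<^bsub>G\<^esub> n \<otimes>\<^bsub>G\<^esub> x \<otimes>\<^bsub>G\<^esub> inv\<^bsub>G\<^esub> (g [^]\<^bsub>G\<^esub> n)) \<one>\<^bsub>G\<^esub> sequentially}"

definition tits_core :: "('a, 'b) monoid_scheme \<Rightarrow> 'a topology \<Rightarrow> 'a set \<Rightarrow> 'a set" where
  "tits_core G T X = generate G (\<Union>x \<in> X \<union> set_inv\<^bsub>G\<^esub> X. T closure_of con G T x)"

text \<open>For subgroups \<open>L \<subseteq> H\<close> of \<open>G\<close>, the space \<open>H/L\<close> is the set of cosets \<open>hL\<close>,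
  \<open>h \<in> H\<close>, with the quotient topology; \<open>H\<close> acts on it by left multiplication.\<close>

definition coset_space :: "('a, 'b) monoid_scheme \<Rightarrow> 'a set \<Rightarrow> 'a set \<Rightarrow> 'a set set" where
  "coset_space G H L = (\<lambda>h. h <#\<^bsub>G\<^esub> L) ` H"

definition coset_topology ::
    "('a, 'b) monoid_scheme \<Rightarrow> 'a topology \<Rightarrow> 'a set \<Rightarrow> 'a set \<Rightarrow> 'a set topology" where
  "coset_topology G T H L =
     topology (\<lambda>U. U \<subseteq> coset_space G H L \<and>
                   openin (subtopology T H) {h \<in> H. h <#\<^bsub>G\<^esub> L \<in> U})"

lemma openin_coset_topology:
  "openin (coset_topology G T H L) U \<longleftrightarrow>
     U \<subseteq> coset_space G H L \<and> openin (subtopology T H) {h \<in> H. h <#\<^bsub>G\<^esub> L \<in> U}"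
proof -
  have "istopology (\<lambda>U. U \<subseteq> coset_space G H L \<and>
          openin (subtopology T H) {h \<in> H. h <#\<^bsub>G\<^esub> L \<in> U})"
    unfolding istopology_def
  proof (intro conjI allI impI)
    fix A B
    assume "A \<subseteq> coset_space G H L \<and> openin (subtopology T H) {h \<in> H. h <#\<^bsub>G\<^esub> L \<in> A}"
      and "B \<subseteq> coset_space G H L \<and> openin (subtopology T H) {h \<in> H. h <#\<^bsub>G\<^esub> L \<in> B}"
    moreover have "{h \<in> H. h <#\<^bsub>G\<^esub> L \<in> A \<inter> B} =
        {h \<in> H. h <#\<^bsub>G\<^esub> L \<in> A} \<inter> {h \<in> H. h <#\<^bsub>G\<^esub> L \<in> B}"
      by auto
    ultimately show "A \<inter> B \<subseteq> coset_space G H L"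
      "openin (subtopology T H) {h \<in> H. h <#\<^bsub>G\<^esub> L \<in> A \<inter> B}"
      by auto
  next
    fix \<K>
    assume K: "\<forall>A\<in>\<K>. A \<subseteq> coset_space G H L \<and>
      openin (subtopology T H) {h \<in> H. h <#\<^bsub>G\<^esub> L \<in> A}"
    then show "\<Union>\<K> \<subseteq> coset_space G H L"
      by blast
    have "{h \<in> H. h <#\<^bsub>G\<^esub> L \<in> \<Union>\<K>} = (\<Union>A\<in>\<K>. {h \<in> H. h <#\<^bsub>G\<^esub> L \<in> A})"
      by auto
    with K show "openin (subtopology T H) {h \<in> H. h <#\<^bsub>G\<^esub> L \<in> \<Union>\<K>}"
      by (metis (no_types, lifting) imageE openin_Union)
  qed
  then show ?thesis
    unfolding coset_topology_def by simp
qed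

lemma topspace_coset_topology:
  assumes "H \<subseteq> topspace T"
  shows "topspace (coset_topology G T H L) = coset_space G H L"
proof (rule antisym)
  show "topspace (coset_topology G T H L) \<subseteq> coset_space G H L"
    using openin_coset_topology openin_topspace by metis
  have "{h \<in> H. h <#\<^bsub>G\<^esub> L \<in> coset_space G H L} = topspace (subtopology T H)"
    using assms by (auto simp: coset_space_def)
  then have "openin (coset_topology G T H L) (coset_space G H L)"
    unfolding openin_coset_topology by (metis order_refl openin_topspace)
  then show "coset_space G H L \<subseteq> topspace (coset_topology G T H L)"
    by (rule openin_subset)
qed

lemma quotient_map_coset_topology:
  assumes "H \<subseteq> topspace T"
  shows "quotient_map (subtopology T H) (coset_topology G T H L) (\<lambda>h. h <#\<^bsub>G\<^esub> L)"
proof -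
  have "topspace (subtopology T H) = H"
    using assms by auto
  then show ?thesis
    unfolding quotient_map_def topspace_coset_topology[OF assms] openin_coset_topology
    by (simp add: coset_space_def)
qed

definition cocompact ::
    "('a, 'b) monoid_scheme \<Rightarrow> 'a topology \<Rightarrow> 'a set \<Rightarrow> 'a set \<Rightarrow> bool" where
  "cocompact G T H L \<longleftrightarrow> compact_space (coset_topology G T H L)"

text \<open>Measures on a locally compact space are by convention Radon.  The last conjunct asks only
  for the part of this convention that matters: the measure is tight.  Every Radon probability
  measure is tight, and if \<open>H\<close> is \<open>\<sigma>\<close>-compact (in particular if it is second countable) then so is
  every Borel probability measure on \<open>H/L\<close>.  Without tightness the notion degenerates: if \<open>\<kappa>\<close> is a
  measurable cardinal, the discrete group of permutations of \<open>\<kappa>\<close> with support of size less than \<open>\<kappa>\<close>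
  leaves invariant a two-valued measure, defined on all subsets of \<open>\<kappa>\<close>, that vanishes on points,
  so that a point stabiliser would have finite covolume.\<close>

definition finite_covolume ::
    "('a, 'b) monoid_scheme \<Rightarrow> 'a topology \<Rightarrow> 'a set \<Rightarrow> 'a set \<Rightarrow> bool" where
  "finite_covolume G T H L \<longleftrightarrow>
     (\<exists>\<mu> :: 'a set measure.
        prob_space \<mu> \<and>
        space \<mu> = coset_space G H L \<and>
        sets \<mu> = sigma_sets (coset_space G H L) {U. openin (coset_topology G T H L) U} \<and>
        (\<forall>h \<in> H. \<forall>A \<in> sets \<mu>. emeasure \<mu> ((\<lambda>c. h <#\<^bsub>G\<^esub> c) ` A) = emeasure \<mu> A) \<and>
        (\<forall>e > 0. \<exists>C. compactin (coset_topology G T H L) C \<and> measure \<mu> C > 1 - e))"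

end

theory Submission
  imports Defs
begin

text \<open>
  Fix \<open>h \<in> H\<close> and a compact open subgroup \<open>U\<close> that is tidy above for \<open>h\<close>; then \<open>U\<close> is tidy above for
  every \<open>g = h\<^sup>n\<close>, \<open>n > 0\<close>, and \<open>con(g) = con(h)\<close>.  If \<open>f \<in> U g U\<close>, then tidiness above and
  compactness yield a single \<open>s \<in> U\<^sub>+\<close> with \<open>f\<^sup>n \<in> U g\<^sup>n s\<^sup>-\<^sup>1\<close> for all \<open>n\<close>, whence
  \<open>con(f) = s con(g) s\<^sup>-\<^sup>1\<close>.  The element \<open>s\<close> is attracted under \<open>g\<^sup>-\<^sup>1\<close> to the compact group
  \<open>U\<^sub>+ \<inter> U\<^sub>-\<close>, so by the theorem of Baumgartner--Willis and Jaworski it can be corrected by an element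
  of that group to lie in \<open>con(g\<^sup>-\<^sup>1)\<close>.  As \<open>U\<close> is also tidy above for \<open>f\<close>, the situation is
  symmetric, and \<open>f\<close> and \<open>g\<close> have the same Tits core.

  It remains to find such an \<open>f\<close> conjugate to an element of \<open>K\<close>.  Compactness of \<open>H/L\<close>, where
  \<open>L\<close> is the closure of \<open>K\<close>, or Poincare recurrence on \<open>H/L\<close>, gives \<open>i\<close> and \<open>n > 0\<close> such that
  \<open>h\<^sup>i L h\<^sup>-\<^sup>i\<close> meets the open set \<open>U h\<^sup>n U\<close>, and then so does \<open>h\<^sup>i K h\<^sup>-\<^sup>i\<close>.
\<close>

section \<open>Conjugation and tidiness above\<close>

context group
begin

definition cj :: "'a \<Rightarrow> 'a \<Rightarrow> 'a" where
  "cj a x = a \<otimes> x \<otimes> inv a"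

lemma mult_inv_cancel [simp]:
  assumes "a \<in> carrier G" "b \<in> carrier G"
  shows "a \<otimes> (inv a \<otimes> b) = b" "inv a \<otimes> (a \<otimes> b) = b"
  using assms by (simp_all flip: m_assoc)

lemma cj_closed [simp, intro]: "\<lbrakk>a \<in> carrier G; x \<in> carrier G\<rbrakk> \<Longrightarrow> cj a x \<in> carrier G"
  by (simp add: cj_def)

lemma cj_one_left [simp]: "x \<in> carrier G \<Longrightarrow> cj \<one> x = x"
  by (simp add: cj_def)

lemma cj_one [simp]: "a \<in> carrier G \<Longrightarrow> cj a \<one> = \<one>"
  by (simp add: cj_def)

lemma cj_mult:
  "\<lbrakk>a \<in> carrier G; x \<in> carrier G; y \<in> carrier G\<rbrakk> \<Longrightarrow> cj a (x \<otimes> y) = cj a x \<otimes> cj a y"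
  by (simp add: cj_def m_assoc)

lemma cj_inv: "\<lbrakk>a \<in> carrier G; x \<in> carrier G\<rbrakk> \<Longrightarrow> cj a (inv x) = inv (cj a x)"
  by (simp add: cj_def m_assoc inv_mult_group)

lemma cj_cj:
  "\<lbrakk>a \<in> carrier G; b \<in> carrier G; x \<in> carrier G\<rbrakk> \<Longrightarrow> cj a (cj b x) = cj (a \<otimes> b) x"
  by (simp add: cj_def m_assoc inv_mult_group)

lemma cj_inv_cancel [simp]:
  assumes "a \<in> carrier G" "x \<in> carrier G"
  shows "cj (inv a) (cj a x) = x" "cj a (cj (inv a) x) = x"
  using assms by (simp_all add: cj_cj)

lemma cj_pow: "\<lbrakk>a \<in> carrier G; x \<in> carrier G\<rbrakk> \<Longrightarrow> cj a (x [^] n) = cj a x [^] (n::nat)"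
  by (induction n) (simp_all add: cj_mult)

lemma cj_pow_add:
  "\<lbrakk>a \<in> carrier G; x \<in> carrier G\<rbrakk> \<Longrightarrow> cj (a [^] m) (cj (a [^] n) x) = cj (a [^] (m + n)) x"
  for m n :: nat
  by (simp add: cj_cj nat_pow_mult)

lemma cj_pow_Suc:
  "\<lbrakk>a \<in> carrier G; x \<in> carrier G\<rbrakk> \<Longrightarrow> cj (a [^] Suc n) x = cj a (cj (a [^] n) x)"
  "\<lbrakk>a \<in> carrier G; x \<in> carrier G\<rbrakk> \<Longrightarrow> cj (a [^] Suc n) x = cj (a [^] n) (cj a x)"
  for n :: nat
  by (metis cj_cj nat_pow_Suc2 nat_pow_closed) (metis cj_cj nat_pow_Suc nat_pow_closed)

lemma cj_pow_inv_cancel [simp]: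
  fixes n :: nat
  assumes "g \<in> carrier G" "x \<in> carrier G"
  shows "cj (g [^] n) (cj (inv g [^] n) x) = x" "cj (inv g [^] n) (cj (g [^] n) x) = x"
  using assms by (simp_all add: nat_pow_inv)

lemma cj_pow_inv_le:
  fixes m n :: nat
  assumes "a \<in> carrier G" "x \<in> carrier G" "m \<le> n"
  shows "cj (a [^] m) (cj (inv a [^] n) x) = cj (inv a [^] (n - m)) x"
proof -
  have "cj (inv a [^] n) x = cj (inv a [^] m) (cj (inv a [^] (n - m)) x)"
    using cj_pow_add[of "inv a" x m "n - m"] assms by simp
  then show ?thesis using assms by simp
qed

lemma cj_pow_stable:
  fixes n :: nat
  assumes "\<And>x. x \<in> C \<Longrightarrow> cj g x \<in> C" "g \<in> carrier G" "C \<subseteq> carrier G" "x \<in> C"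
  shows "cj (g [^] n) x \<in> C"
proof (induction n)
  case (Suc n)
  then show ?case
    using assms cj_pow_Suc(1)[of g x n] by (metis subsetD)
qed (use assms in auto)

lemma l_coset_r_coset_eq_cj:
  "A \<subseteq> carrier G \<Longrightarrow> t \<in> carrier G \<Longrightarrow> (t <# A) #> inv t = cj t ` A"
  by (auto simp: l_coset_def r_coset_def cj_def)

text \<open>In Willis's notation \<open>minus_part g U\<close> is \<open>U\<^sub>-\<close> and \<open>minus_part (inv g) U\<close> is \<open>U\<^sub>+\<close>.\<close>

definition minus_part :: "'a \<Rightarrow> 'a set \<Rightarrow> 'a set" where
  "minus_part g U = {x \<in> carrier G. \<forall>n::nat. cj (g [^] n) x \<in> U}"

lemma minus_part_subset: "minus_part g U \<subseteq> U"
proof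
  fix x assume "x \<in> minus_part g U"
  then have "x \<in> carrier G" "cj (g [^] (0::nat)) x \<in> U" unfolding minus_part_def by blast+
  then show "x \<in> U" by simp
qed

lemma minus_partD: "x \<in> minus_part g U \<Longrightarrow> cj (g [^] n) x \<in> U" for n :: nat
  by (simp add: minus_part_def)

lemma minus_part_carrier: "x \<in> minus_part g U \<Longrightarrow> x \<in> carrier G"
  by (simp add: minus_part_def)

lemma cj_mem_minus_part:
  "\<lbrakk>x \<in> minus_part g U; g \<in> carrier G\<rbrakk> \<Longrightarrow> cj (g [^] k) x \<in> minus_part g U" for k :: nat
  by (auto simp: minus_part_def cj_pow_add)

text \<open>One conjugation shifts the conditions that define \<open>U\<^sub>+\<close> by one place.
  All of them except the one for exponent 0 are then conditions on \<open>x\<close> itself, and that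
  one, \<open>cj g x \<in> U\<close>, is supplied by \<open>x \<in> U\<^sub>-\<close>.\<close>

lemma cj_mem_core:
  assumes "x \<in> minus_part g U" "x \<in> minus_part (inv g) U" "g \<in> carrier G"
  shows "cj g x \<in> minus_part g U" "cj g x \<in> minus_part (inv g) U"
proof -
  have xc: "x \<in> carrier G" using assms(1) by (rule minus_part_carrier)
  show gx: "cj g x \<in> minus_part g U" using cj_mem_minus_part[OF assms(1,3), of 1] assms(3) by simp
  have "cj (inv g [^] n) (cj g x) \<in> U" for n :: nat
  proof (cases n)
    case 0
    then show ?thesis using subsetD[OF minus_part_subset gx] xc assms(3) by simp
  next
    case (Suc m)
    then have "cj (inv g [^] n) (cj g x) = cj (inv g [^] m) x"
      using cj_pow_Suc(2)[of "inv g" "cj g x" m] xc assms(3) by simp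
    then show ?thesis using minus_partD[OF assms(2)] by simp
  qed
  then show "cj g x \<in> minus_part (inv g) U" using xc assms(3) by (simp add: minus_part_def)
qed

lemma subgroup_cj_vimage:
  assumes "subgroup U G" "a \<in> carrier G"
  shows "subgroup {x \<in> carrier G. cj a x \<in> U} G"
proof (rule subgroupI)
  have "\<one> \<in> {x \<in> carrier G. cj a x \<in> U}"
    using assms by (simp add: subgroup.one_closed)
  then show "{x \<in> carrier G. cj a x \<in> U} \<noteq> {}" by blast
qed (use assms in \<open>auto simp: cj_mult cj_inv subgroup.m_closed subgroup.m_inv_closed\<close>)

lemma subgroup_minus_part:
  assumes "subgroup U G" "g \<in> carrier G"
  shows "subgroup (minus_part g U) G"
proof (rule subgroupI)
  have "\<one> \<in> minus_part g U"
    using assms by (simp add: minus_part_def subgroup.one_closed)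
  then show "minus_part g U \<noteq> {}" by blast
qed (use assms in \<open>auto simp: minus_part_def cj_mult cj_inv subgroup.m_closed subgroup.m_inv_closed\<close>)

text \<open>Willis's factorisation \<open>U = U\<^sub>+ U\<^sub>-\<close>; the reverse inclusion is
  automatic when \<open>U\<close> is a subgroup.\<close>

definition tidy_above :: "'a \<Rightarrow> 'a set \<Rightarrow> bool" where
  "tidy_above g U \<longleftrightarrow>
     (\<forall>x\<in>U. \<exists>a\<in>minus_part (inv g) U. \<exists>b\<in>minus_part g U. x = a \<otimes> b)"

text \<open>Invert the factorisation of \<open>inv x\<close>: both parts are subgroups, so
  \<open>U\<^sub>+ U\<^sub>- = U\<close> also gives \<open>U\<^sub>- U\<^sub>+ = U\<close>.\<close>

lemma tidy_above_swap:
  assumes "tidy_above g U" "subgroup U G" "g \<in> carrier G" "x \<in> U"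
  shows "\<exists>a\<in>minus_part g U. \<exists>b\<in>minus_part (inv g) U. x = a \<otimes> b"
proof -
  have x: "x \<in> carrier G" using subgroup.mem_carrier[OF assms(2,4)] .
  have "inv x \<in> U" using assms by (simp add: subgroup.m_inv_closed)
  then obtain a b where ab: "a \<in> minus_part (inv g) U" "b \<in> minus_part g U" "inv x = a \<otimes> b"
    using assms(1) unfolding tidy_above_def by blast
  then have c: "a \<in> carrier G" "b \<in> carrier G"
    by (auto simp: minus_part_carrier)
  have "x = inv (a \<otimes> b)" using ab(3) x by (metis inv_inv)
  also have "\<dots> = inv b \<otimes> inv a" using c by (simp add: inv_mult_group)
  finally show ?thesis
    using subgroup.m_inv_closed[OF subgroup_minus_part[OF assms(2,3)] ab(2)]
      subgroup.m_inv_closed[OF subgroup_minus_part[OF assms(2) inv_closed[OF assms(3)]] ab(1)]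
    by blast
qed

lemma tidy_above_inv:
  assumes "tidy_above g U" "subgroup U G" "g \<in> carrier G"
  shows "tidy_above (inv g) U"
  using tidy_above_swap[OF assms] assms unfolding tidy_above_def by simp

text \<open>The powers of \<open>g [^] n\<close> are among those of \<open>g\<close>, so fewer
  conditions are imposed. Both factors of \<open>U\<close> can thus only grow, and tidiness above
  passes to powers.\<close>

lemma minus_part_pow: "g \<in> carrier G \<Longrightarrow> minus_part g U \<subseteq> minus_part (g [^] n) U" for n :: nat
  by (auto simp: minus_part_def nat_pow_pow)

lemma tidy_above_pow:
  fixes n :: nat
  assumes "tidy_above g U" "g \<in> carrier G"
  shows "tidy_above (g [^] n) U"
proof -
  have "minus_part (inv g) U \<subseteq> minus_part (inv (g [^] n)) U"
    using assms minus_part_pow[of "inv g" U n] by (simp add: nat_pow_inv)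
  then show ?thesis
    using assms minus_part_pow[of g U n] unfolding tidy_above_def by (meson subsetD)
qed

end

section \<open>Compactness along sequences and chains of closed sets\<close>

lemma compactin_nested_Int:
  fixes A :: "nat \<Rightarrow> 'a set"
  assumes K: "compactin X K" and A: "\<And>n. closedin X (A n)" "\<And>n. A (Suc n) \<subseteq> A n"
    and ne: "\<And>n. K \<inter> A n \<noteq> {}"
  shows "K \<inter> (\<Inter>n. A n) \<noteq> {}"
proof -
  have "decseq (\<lambda>n. K \<inter> A n)"
    using A(2) by (intro decseq_SucI Int_mono order_refl)
  then have "(\<Inter>n. K \<inter> A n) \<noteq> {}"
    using K ne
    by (intro compact_space_imp_nest[of "subtopology X K"] compact_space_subtopology
          closedin_subtopology_Int_closed A(1))
  then show ?thesis by auto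
qed

text \<open>Otherwise the chain together with the complement of \<open>W\<close> has the finite
  intersection property: finitely many members of the chain have a least one, and it contains a
  point outside \<open>W\<close>. By compactness of one member, \<open>\<Inter>\<C>\<close> would
  then meet the complement of \<open>W\<close>.\<close>

lemma compactin_chain_Int_subset:
  assumes "\<C> \<noteq> {}" and K: "\<And>A. A \<in> \<C> \<Longrightarrow> compactin X A" and X: "Hausdorff_space X"
    and ch: "\<And>A B. \<lbrakk>A \<in> \<C>; B \<in> \<C>\<rbrakk> \<Longrightarrow> A \<subseteq> B \<or> B \<subseteq> A"
    and W: "openin X W" "\<Inter>\<C> \<subseteq> W"
  shows "\<exists>A\<in>\<C>. A \<subseteq> W"
proof (rule ccontr)
  assume neg: "\<not> ?thesis"
  obtain A0 where A0: "A0 \<in> \<C>" using assms(1) by blast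
  let ?\<U> = "insert (topspace X - W) \<C>"
  have "A0 \<inter> \<Inter>\<F> \<noteq> {}" if F: "finite \<F>" "\<F> \<subseteq> ?\<U>" for \<F>
  proof -
    have fin: "finite (insert A0 (\<F> - {topspace X - W}))" using F by simp
    have sub: "insert A0 (\<F> - {topspace X - W}) \<subseteq> \<C>" using F A0 by auto
    obtain m where m: "m \<in> insert A0 (\<F> - {topspace X - W})"
      and min: "\<forall>x\<in>insert A0 (\<F> - {topspace X - W}). x \<le> m \<longrightarrow> m = x"
      using finite_has_minimal[OF fin insert_not_empty] by (rule bexE)
    have least: "m \<subseteq> x" if "x \<in> insert A0 (\<F> - {topspace X - W})" for x
      using ch[of m x] min that sub m by blast
    have "m \<in> \<C>" using m sub by blast
    then obtain z where "z \<in> m" "z \<notin> W" using neg by blast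
    moreover have "z \<in> topspace X" using K[OF \<open>m \<in> \<C>\<close>] \<open>z \<in> m\<close> compactin_subset_topspace by blast
    ultimately have "z \<in> A0 \<inter> \<Inter>\<F>" using least by blast
    then show ?thesis by blast
  qed
  moreover have "\<forall>C\<in>?\<U>. closedin X C"
    using K X W by (auto simp: compactin_imp_closedin)
  ultimately have "A0 \<inter> \<Inter>?\<U> \<noteq> {}"
    using K[OF A0, unfolded compactin_fip, THEN conjunct2, rule_format, of ?\<U>] by blast
  then show False using W by auto
qed

lemma compactin_nested_subset:
  fixes A :: "nat \<Rightarrow> 'a set"
  assumes "\<And>n. compactin X (A n)" "Hausdorff_space X" "\<And>n. A (Suc n) \<subseteq> A n"
    and "openin X W" "(\<Inter>n. A n) \<subseteq> W"
  obtains n where "A n \<subseteq> W"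
proof -
  have "A m \<subseteq> A n \<or> A n \<subseteq> A m" for m n
    using lift_Suc_antimono_le[of A, OF assms(3)] nat_le_linear[of m n] by blast
  then have "\<exists>B\<in>range A. B \<subseteq> W"
    using assms(1,2,4,5) by (intro compactin_chain_Int_subset[where X=X]) auto
  then show ?thesis using that by blast
qed

section \<open>Compact open subgroups\<close>

context topological_group
begin

lemma openin_carrier: "openin T U \<Longrightarrow> U \<subseteq> carrier G"
  using openin_subset topspace_eq by blast

lemma continuous_map_mult:
  assumes "continuous_map X T f" "continuous_map X T h"
  shows "continuous_map X T (\<lambda>x. f x \<otimes> h x)"
proof -
  have "continuous_map X (prod_topology T T) (\<lambda>x. (f x, h x))"
    using assms by (simp add: continuous_map_pairwise o_def)
  from continuous_map_compose[OF this continuous_mult] show ?thesis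
    by (simp add: o_def)
qed

lemma continuous_map_translate:
  assumes "a \<in> carrier G" "b \<in> carrier G"
  shows "continuous_map T T (\<lambda>x. a \<otimes> x \<otimes> b)"
  using assms by (intro continuous_map_mult) (simp_all add: topspace_eq)

lemma continuous_map_l_mult: "a \<in> carrier G \<Longrightarrow> continuous_map T T (\<lambda>x. a \<otimes> x)"
  by (intro continuous_map_mult) (simp_all add: topspace_eq)

lemma continuous_map_cj: "a \<in> carrier G \<Longrightarrow> continuous_map T T (cj a)"
  unfolding cj_def by (rule continuous_map_translate) auto

lemma openin_l_mult_vimage:
  "\<lbrakk>openin T U; a \<in> carrier G\<rbrakk> \<Longrightarrow> openin T {x \<in> carrier G. a \<otimes> x \<in> U}"
  using openin_continuous_map_preimage[OF continuous_map_l_mult] by (simp add: topspace_eq)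

lemma openin_translate_vimage:
  "\<lbrakk>openin T U; a \<in> carrier G; b \<in> carrier G\<rbrakk> \<Longrightarrow> openin T {x \<in> carrier G. a \<otimes> x \<otimes> b \<in> U}"
  using openin_continuous_map_preimage[OF continuous_map_translate] by (simp add: topspace_eq)

lemma closedin_translate_vimage:
  "\<lbrakk>closedin T U; a \<in> carrier G; b \<in> carrier G\<rbrakk> \<Longrightarrow> closedin T {x \<in> carrier G. a \<otimes> x \<otimes> b \<in> U}"
  using closedin_continuous_map_preimage[OF continuous_map_translate] by (simp add: topspace_eq)

lemma openin_cj_vimage:
  "\<lbrakk>openin T U; a \<in> carrier G\<rbrakk> \<Longrightarrow> openin T {x \<in> carrier G. cj a x \<in> U}"
  using openin_continuous_map_preimage[OF continuous_map_cj] by (simp add: topspace_eq)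

lemma closedin_cj_vimage:
  "\<lbrakk>closedin T U; a \<in> carrier G\<rbrakk> \<Longrightarrow> closedin T {x \<in> carrier G. cj a x \<in> U}"
  using closedin_continuous_map_preimage[OF continuous_map_cj] by (simp add: topspace_eq)

lemma compactin_cj_image: "\<lbrakk>compactin T U; a \<in> carrier G\<rbrakk> \<Longrightarrow> compactin T (cj a ` U)"
  using image_compactin[OF _ continuous_map_cj] .

lemma cj_vimage_eq_image:
  assumes "a \<in> carrier G" "U \<subseteq> carrier G"
  shows "{x \<in> carrier G. cj a x \<in> U} = cj (inv a) ` U"
proof -
  have "x \<in> cj (inv a) ` U" if "x \<in> carrier G" "cj a x \<in> U" for x
    using that assms by (intro image_eqI[of _ _ "cj a x"]) auto
  then show ?thesis using assms by auto
qed

lemma closedin_minus_part: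
  assumes "closedin T U" "g \<in> carrier G"
  shows "closedin T (minus_part g U)"
proof -
  have "minus_part g U = (\<Inter>n::nat. {x \<in> carrier G. cj (g [^] n) x \<in> U})"
    by (auto simp: minus_part_def)
  then show ?thesis
    using assms by (auto intro!: closedin_cj_vimage)
qed

lemma compactin_closedin: "compactin T U \<Longrightarrow> closedin T U"
  using Hausdorff compactin_imp_closedin by blast

lemma compactin_minus_part:
  assumes "compactin T U" "g \<in> carrier G"
  shows "compactin T (minus_part g U)"
  using closed_compactin[OF assms(1) minus_part_subset]
    closedin_minus_part[OF compactin_closedin] assms by blast

lemma openin_r_mult_vimage:
  "\<lbrakk>openin T U; a \<in> carrier G\<rbrakk> \<Longrightarrow> openin T {x \<in> carrier G. x \<otimes> a \<in> U}"
  using openin_translate_vimage[of U \<one> a] by (simp cong: conj_cong)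

text \<open>The complement is a union of left cosets \<open>a U\<close>, each of them open.\<close>

lemma open_subgroup_closed:
  assumes "subgroup U G" "openin T U"
  shows "closedin T U"
proof -
  have sub: "U \<subseteq> carrier G" using assms(1) subgroup.subset by blast
  have "carrier G - U = (\<Union>a\<in>carrier G - U. {x \<in> carrier G. inv a \<otimes> x \<in> U})" (is "_ = ?R")
  proof
    show "carrier G - U \<subseteq> ?R" using assms by (auto simp: subgroup.one_closed)
    have "inv a \<otimes> x \<notin> U" if "a \<in> carrier G" "a \<notin> U" "x \<in> U" for a x
    proof
      assume "inv a \<otimes> x \<in> U"
      then have "x \<otimes> inv (inv a \<otimes> x) \<in> U"
        using that assms by (simp add: subgroup.m_closed subgroup.m_inv_closed)
      then show False using that sub by (auto simp: inv_mult_group subset_iff)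
    qed
    then show "?R \<subseteq> carrier G - U" by auto
  qed
  moreover have "openin T ?R"
    using assms by (auto intro!: openin_l_mult_vimage)
  ultimately show ?thesis
    using sub by (simp add: closedin_def topspace_eq)
qed

end

locale tdlc_group = topological_group +
  assumes totally_disconnected: "totally_disconnected_space T"
    and locally_compact: "locally_compact_space T"
begin

definition compact_open_subgroup :: "'a set \<Rightarrow> bool" where
  "compact_open_subgroup U \<longleftrightarrow> subgroup U G \<and> openin T U \<and> compactin T U"

lemma compact_open_subgroupD:
  assumes "compact_open_subgroup U"
  shows "subgroup U G" "openin T U" "compactin T U" "closedin T U" "\<one> \<in> U" "U \<subseteq> carrier G"
  using assms subgroup.one_closed subgroup.subset
  unfolding compact_open_subgroup_def by (blast intro: compactin_closedin)+

lemma compact_open_subgroup_Int: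
  "\<lbrakk>compact_open_subgroup U; compact_open_subgroup V\<rbrakk> \<Longrightarrow> compact_open_subgroup (U \<inter> V)"
  unfolding compact_open_subgroup_def
  by (auto simp: subgroups_Inter_pair Hausdorff intro: compact_Int_closedin closed_Int_compactin compactin_closedin)

lemma compact_open_subgroup_cj_vimage:
  assumes "compact_open_subgroup U" "a \<in> carrier G"
  shows "compact_open_subgroup {x \<in> carrier G. cj a x \<in> U}"
  unfolding compact_open_subgroup_def
proof (intro conjI subgroup_cj_vimage openin_cj_vimage)
  show "compactin T {x \<in> carrier G. cj a x \<in> U}"
    using compactin_cj_image[of U "inv a"] cj_vimage_eq_image[of a U] compact_open_subgroupD[OF assms(1)] assms(2)
    by simp
qed (use assms compact_open_subgroupD in auto)

text \<open>The component of \<open>\<one>\<close> is a point, so local compactness gives a compact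
  open \<open>B\<close> with \<open>\<one> \<in> B \<subseteq> W\<close>. The right stabiliser of
  \<open>B\<close> is a subgroup; it lies in \<open>B\<close> because \<open>\<one> \<in> B\<close>,
  and compactness of \<open>B\<close> makes it open.\<close>

lemma van_dantzig:
  assumes "openin T W" "\<one> \<in> W"
  obtains U where "compact_open_subgroup U" "U \<subseteq> W"
proof -
  obtain O1 K where OK: "openin T O1" "compactin T K" "\<one> \<in> O1" "O1 \<subseteq> K"
    using locally_compact unfolding locally_compact_space_def by (metis one_closed topspace_eq)
  have "{\<one>} \<in> connected_components_of T"
    using totally_disconnected unfolding totally_disconnected_space_def connected_components_of_def
    by (metis imageI one_closed topspace_eq)
  moreover have "compactin T {\<one>}" by (simp add: topspace_eq)
  moreover have "openin T (W \<inter> O1)" using assms OK by blast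
  ultimately obtain B B' where B: "openin T B" "openin T B'" "disjnt B B'" "B \<union> B' = topspace T"
    "\<one> \<in> B" "B \<subseteq> W \<inter> O1"
    using wilder_locally_compact_component_thm[OF locally_compact Hausdorff, of "{\<one>}" "W \<inter> O1"] assms OK
    by auto
  have "B = topspace T - B'" using B openin_subset unfolding disjnt_def by blast
  then have clB: "closedin T B" using B by blast
  have cB: "compactin T B"
    using closed_compactin[OF OK(2) _ clB] B OK by blast
  have Bc: "B \<subseteq> carrier G" using openin_carrier B by blast
  \<comment> \<open>\<open>S\<close> consists of the \<open>x\<close> with
    \<open>B x \<subseteq> B\<close>; asking the same of \<open>inv x\<close> yields the stabiliser
    \<open>B x = B\<close>.\<close>
  define S where "S = {x \<in> carrier G. \<forall>b\<in>B. b \<otimes> x \<in> B}"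
  define U where "U = {x \<in> S. inv x \<in> S}"
  have "subgroup U G"
  proof (rule subgroupI)
    have "\<one> \<in> U" using Bc by (auto simp: U_def S_def)
    then show "U \<noteq> {}" by blast
    show "x \<otimes> y \<in> U" if "x \<in> U" "y \<in> U" for x y
    proof -
      have S: "x \<in> S" "inv x \<in> S" "y \<in> S" "inv y \<in> S" using that by (auto simp: U_def)
      have mult: "a \<otimes> b \<in> S" if "a \<in> S" "b \<in> S" for a b
      proof -
        have "c \<otimes> (a \<otimes> b) \<in> B" if "c \<in> B" for c
        proof -
          have "c \<otimes> (a \<otimes> b) = (c \<otimes> a) \<otimes> b"
            using that Bc \<open>a \<in> S\<close> \<open>b \<in> S\<close> by (auto simp: S_def m_assoc)
          then show ?thesis using that \<open>a \<in> S\<close> \<open>b \<in> S\<close> by (auto simp: S_def)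
        qed
        then show ?thesis using that by (auto simp: S_def)
      qed
      have "inv (x \<otimes> y) = inv y \<otimes> inv x"
        using S by (intro inv_mult_group) (auto simp: S_def)
      then show ?thesis using mult S by (auto simp: U_def)
    qed
  qed (auto simp: U_def S_def)
  moreover have "U \<subseteq> B"
  proof
    fix x assume "x \<in> U"
    then have "x \<in> carrier G" "\<one> \<otimes> x \<in> B" using B by (auto simp: U_def S_def)
    then show "x \<in> B" by simp
  qed
  moreover have "openin T U"
  proof -
    text \<open>The tube lemma makes a whole neighbourhood of the unit stabilise \<open>B\<close>.\<close>
    let ?O = "{z \<in> topspace (prod_topology T T). (\<lambda>(x, y). x \<otimes> y) z \<in> B}"
    have "openin (prod_topology T T) ?O"
      using openin_continuous_map_preimage[OF continuous_mult B(1)] .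
    moreover have "B \<times> {\<one>} \<subseteq> ?O" using Bc by (auto simp: topspace_eq)
    ultimately obtain A N where N: "openin T A" "openin T N" "B \<subseteq> A" "{\<one>} \<subseteq> N" "A \<times> N \<subseteq> ?O"
      using Wallace_theorem_prod_topology[OF cB \<open>compactin T {\<one>}\<close>] by blast
    have "b \<otimes> x \<in> B" if "x \<in> N" "b \<in> B" for x b
      using subsetD[OF N(5), of "(b, x)"] N(3) that by auto
    then have "N \<subseteq> S" using openin_carrier[OF N(2)] unfolding S_def by auto
    define M where "M = N \<inter> {x \<in> carrier G. inv x \<in> N}"
    have "openin T M"
      unfolding M_def
      using openin_continuous_map_preimage[OF continuous_inv N(2)] N(2) by (auto simp: topspace_eq)
    have "M \<subseteq> U" "\<one> \<in> M"
      using \<open>N \<subseteq> S\<close> N by (auto simp: M_def U_def)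
    have "\<exists>V. openin T V \<and> x \<in> V \<and> V \<subseteq> U" if "x \<in> U" for x
    proof (intro exI conjI)
      have x: "x \<in> carrier G" using that by (auto simp: U_def S_def)
      show "openin T {y \<in> carrier G. inv x \<otimes> y \<in> M}"
        using \<open>openin T M\<close> x by (intro openin_l_mult_vimage) auto
      show "x \<in> {y \<in> carrier G. inv x \<otimes> y \<in> M}" using x \<open>\<one> \<in> M\<close> by simp
      show "{y \<in> carrier G. inv x \<otimes> y \<in> M} \<subseteq> U"
      proof
        fix y assume y: "y \<in> {y \<in> carrier G. inv x \<otimes> y \<in> M}"
        then have "x \<otimes> (inv x \<otimes> y) \<in> U"
          using that \<open>M \<subseteq> U\<close> \<open>subgroup U G\<close> by (auto intro: subgroup.m_closed)
        then show "y \<in> U" using x y by simp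
      qed
    qed
    then show ?thesis using openin_subopen by blast
  qed
  ultimately have "compact_open_subgroup U"
    using closed_compactin[OF cB _ open_subgroup_closed] unfolding compact_open_subgroup_def
    by blast
  then show thesis using that \<open>U \<subseteq> B\<close> B by blast
qed


text \<open>Multiplication maps \<open>{\<one>} \<times> C\<close> into \<open>W\<close>, hence by
  Wallace's theorem also a product neighbourhood of it; the factor at \<open>\<one>\<close> is
  shrunk to a subgroup.\<close>

lemma tube:
  assumes "compactin T C" "openin T W" "C \<subseteq> W"
  obtains N where "compact_open_subgroup N" "\<And>n c. \<lbrakk>n \<in> N; c \<in> C\<rbrakk> \<Longrightarrow> n \<otimes> c \<in> W"
proof -
  let ?O = "{z \<in> topspace (prod_topology T T). (\<lambda>(x, y). x \<otimes> y) z \<in> W}"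
  have "openin (prod_topology T T) ?O"
    using openin_continuous_map_preimage[OF continuous_mult assms(2)] .
  moreover have "{\<one>} \<times> C \<subseteq> ?O"
    using assms compactin_subset_topspace[OF assms(1)] by (auto simp: topspace_eq subset_iff)
  moreover have "compactin T {\<one>}" by (simp add: topspace_eq)
  ultimately obtain M A where M: "openin T M" "openin T A" "{\<one>} \<subseteq> M" "C \<subseteq> A" "M \<times> A \<subseteq> ?O"
    using Wallace_theorem_prod_topology[OF \<open>compactin T {\<one>}\<close> assms(1)] by blast
  obtain N where "compact_open_subgroup N" "N \<subseteq> M" using van_dantzig[OF M(1)] M(3) by blast
  have "n \<otimes> c \<in> W" if "n \<in> N" "c \<in> C" for n c
    using subsetD[OF M(5), of "(n, c)"] M(4) \<open>N \<subseteq> M\<close> that by auto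
  then show thesis using that[OF \<open>compact_open_subgroup N\<close>] by blast
qed

text \<open>Convergence to \<open>\<one>\<close> thus survives conjugation by elements that vary
  within a compact set. This is how orbits under \<open>f\<close> and \<open>g\<close> that differ
  by elements of \<open>U\<close> are compared.\<close>

lemma uniform_conjugation:
  assumes "compactin T C" "openin T W" "\<one> \<in> W"
  obtains N where "compact_open_subgroup N" "\<And>n c. \<lbrakk>n \<in> N; c \<in> C\<rbrakk> \<Longrightarrow> cj c n \<in> W"
proof -
  let ?f = "\<lambda>z. fst z \<otimes> snd z \<otimes> inv (fst z)"
  have "continuous_map (prod_topology T T) T ?f"
    using continuous_map_compose[OF continuous_map_fst continuous_inv]
    by (intro continuous_map_mult continuous_map_fst continuous_map_snd) (simp add: o_def)
  let ?O = "{z \<in> topspace (prod_topology T T). ?f z \<in> W}"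
  have "openin (prod_topology T T) ?O"
    using openin_continuous_map_preimage[OF \<open>continuous_map _ T ?f\<close> assms(2)] .
  moreover have "C \<times> {\<one>} \<subseteq> ?O"
    using assms compactin_subset_topspace[OF assms(1)] by (auto simp: topspace_eq subset_iff)
  moreover have "compactin T {\<one>}" by (simp add: topspace_eq)
  ultimately obtain A M where M: "openin T A" "openin T M" "C \<subseteq> A" "{\<one>} \<subseteq> M" "A \<times> M \<subseteq> ?O"
    using Wallace_theorem_prod_topology[OF assms(1) \<open>compactin T {\<one>}\<close>] by blast
  obtain N where "compact_open_subgroup N" "N \<subseteq> M" using van_dantzig[OF M(2)] M(4) by blast
  have "cj c n \<in> W" if "n \<in> N" "c \<in> C" for n c
    using subsetD[OF M(5), of "(c, n)"] M(3) \<open>N \<subseteq> M\<close> that by (auto simp: cj_def)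
  then show thesis using that[OF \<open>compact_open_subgroup N\<close>] by blast
qed

end

section \<open>Tidying and shadowing\<close>

context tdlc_group
begin

text \<open>Willis's tidying step: intersecting \<open>U\<close> with finitely many of its
  conjugates makes it tidy above. It is done relative to a closed invariant subgroup
  \<open>C\<close>, so that it applies both to \<open>G\<close> itself and inside a compact stable
  group, while \<open>V\<close> stays open in \<open>G\<close>.\<close>

lemma exists_tidy_above:
  assumes U: "compact_open_subgroup U" and C: "subgroup C G" "closedin T C" and g: "g \<in> carrier G"
    and stable: "\<And>x. x \<in> C \<Longrightarrow> cj g x \<in> C" "\<And>x. x \<in> C \<Longrightarrow> cj (inv g) x \<in> C"
  obtains V where "compact_open_subgroup V" "V \<subseteq> U" "tidy_above g (V \<inter> C)"
proof -
  let ?h = "inv g"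
  have h: "?h \<in> carrier G" using g by simp
  have Cc: "C \<subseteq> carrier G" using C subgroup.subset by blast
  note Uc = compact_open_subgroupD(6)[OF U]
  have stable_pow: "cj (?h [^] n) x \<in> C" if "x \<in> C" for x and n :: nat
    using cj_pow_stable[of C ?h x n] stable(2) h Cc that by blast
  \<comment> \<open>\<open>B n\<close> is the intersection of the
    \<open>g [^] i U g [^] (-i)\<close> for \<open>i \<le> n\<close>; the compact groups
    \<open>A n\<close> decrease to \<open>M\<close>, the plus part of
    \<open>U \<inter> C\<close>.\<close>
  define B where "B n = {x \<in> carrier G. \<forall>i\<le>n. cj (?h [^] i) x \<in> U}" for n :: nat
  define A where "A n = B n \<inter> C" for n
  define M where "M = minus_part ?h (U \<inter> C)"
  have B_Suc: "B (Suc n) = B n \<inter> {x \<in> carrier G. cj (?h [^] Suc n) x \<in> U}" for n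
    by (auto simp: B_def le_Suc_eq simp del: nat_pow_Suc)
  have B_compact_open: "compact_open_subgroup (B n)" for n
  proof (induction n)
    case 0
    have "B 0 = U" using Uc by (auto simp: B_def)
    then show ?case using U by simp
  next
    case (Suc n)
    then show ?case
      unfolding B_Suc using U h
      by (intro compact_open_subgroup_Int compact_open_subgroup_cj_vimage) auto
  qed
  have subA: "subgroup (A n) G" for n
    unfolding A_def using compact_open_subgroupD(1)[OF B_compact_open] C(1)
    by (rule subgroups_Inter_pair)
  have cA: "compactin T (A n)" for n
    unfolding A_def using compact_open_subgroupD(3)[OF B_compact_open] C(2)
    by (simp add: compact_Int_closedin)
  have A_mono: "A n \<subseteq> A m" if "m \<le> n" for m n
    using that by (auto simp: A_def B_def)
  have M_A: "M \<subseteq> A n" for n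
    using minus_part_subset[of ?h "U \<inter> C"] unfolding M_def A_def B_def
    by (auto simp: minus_part_def)
  have A_M: "(\<Inter>n. A n) \<subseteq> M"
    using stable_pow unfolding M_def A_def B_def minus_part_def by auto
  have subUC: "subgroup (U \<inter> C) G"
    using compact_open_subgroupD(1)[OF U] C(1) by (rule subgroups_Inter_pair)
  have subM: "subgroup M G"
    unfolding M_def by (rule subgroup_minus_part[OF subUC h])
  have Mc: "M \<subseteq> carrier G" using subM subgroup.subset by blast
  have cM: "compactin T M"
    unfolding M_def using compact_open_subgroupD(3)[OF U] C(2) h
    by (intro compactin_minus_part) (auto simp: compact_Int_closedin)
  have M_cj: "cj (?h [^] k) a \<in> M" if "a \<in> M" for a and k :: nat
    using that h unfolding M_def by (rule cj_mem_minus_part)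

  \<comment> \<open>\<open>W\<close> is the product of \<open>M\<close> with the conjugate of
    \<open>U\<close> by \<open>inv g\<close>, an open set around \<open>M\<close>; so the nested
    \<open>A n\<close> lie in it from some \<open>N\<close> on.\<close>
  define W where "W = (\<Union>a\<in>M. {x \<in> carrier G. inv a \<otimes> x \<in> {y \<in> carrier G. cj g y \<in> U}})"
  have "openin T {x \<in> carrier G. inv a \<otimes> x \<in> {y \<in> carrier G. cj g y \<in> U}}" if "a \<in> M" for a
    using that Mc g compact_open_subgroupD(2)[OF U]
    by (intro openin_l_mult_vimage openin_cj_vimage) auto
  then have "openin T W"
    unfolding W_def by blast
  moreover have "M \<subseteq> W"
    using Mc g compact_open_subgroupD(5)[OF U] unfolding W_def by force
  ultimately obtain N where N: "A N \<subseteq> W"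
    using compactin_nested_subset[of T A W] cA Hausdorff A_mono A_M
    by (meson dual_order.trans lessI less_imp_le)
  \<comment> \<open>Since \<open>A n \<subseteq> W\<close>, dividing by some
    \<open>a \<in> M\<close> leaves an element whose conjugate \<open>u\<close> under
    \<open>g\<close> is still in \<open>U\<close>. The conditions already known move up by one
    index, which puts \<open>u\<close> into \<open>A (Suc n)\<close>.\<close>
  have split: "\<exists>a\<in>M. \<exists>u\<in>A (Suc n). y = a \<otimes> cj ?h u" if n: "N \<le> n" and y: "y \<in> A n" for n y
  proof -
    have yc: "y \<in> carrier G" using y subgroup.subset[OF subA] by blast
    have "y \<in> W" using A_mono[OF n] N y by blast
    then obtain a where a: "a \<in> M" "cj g (inv a \<otimes> y) \<in> U" unfolding W_def by blast
    have ac: "a \<in> carrier G" using a Mc by blast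
    have ay: "inv a \<otimes> y \<in> A n"
      using a(1) M_A y subA[of n] by (meson subgroup.m_closed subgroup.m_inv_closed subsetD)
    define u where "u = cj g (inv a \<otimes> y)"
    have u: "u \<in> carrier G" "cj ?h u = inv a \<otimes> y"
      using ac yc g by (auto simp: u_def)
    have "cj (?h [^] i) u \<in> U" if "i \<le> Suc n" for i
    proof (cases i)
      case 0 then show ?thesis using a u by (simp add: u_def)
    next
      case (Suc j)
      then have "cj (?h [^] i) u = cj (?h [^] j) (inv a \<otimes> y)"
        using cj_pow_Suc(2)[OF h u(1), of j] u(2) by (simp del: nat_pow_Suc)
      then show ?thesis using ay Suc that by (auto simp: A_def B_def)
    qed
    moreover have "u \<in> C" using ay stable(1) by (auto simp: A_def u_def)
    ultimately have "u \<in> A (Suc n)" using u by (auto simp: A_def B_def)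
    moreover have "y = a \<otimes> cj ?h u" using u ac yc by simp
    ultimately show ?thesis using a by blast
  qed
  \<comment> \<open>Iterating \<open>split\<close> collects the left factors in \<open>M\<close>,
    which is stable under \<open>?h\<close>. The remaining factor is a \<open>k\<close>-fold
    pullback, so it can be conjugated \<open>k\<close> times by \<open>g\<close>.\<close>
  have tele: "\<exists>a\<in>M. \<exists>z\<in>A (N + k). x = a \<otimes> cj (?h [^] k) z" if "x \<in> A N" for x k
  proof (induction k)
    case 0
    have "x \<in> carrier G" using that subgroup.subset[OF subA] by blast
    then have "x = \<one> \<otimes> cj (?h [^] (0::nat)) x" by simp
    then show ?case using that subgroup.one_closed[OF subM] by (metis add.right_neutral)
  next
    case (Suc k)
    then obtain a z where az: "a \<in> M" "z \<in> A (N + k)" "x = a \<otimes> cj (?h [^] k) z" by blast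
    obtain b u where bu: "b \<in> M" "u \<in> A (Suc (N + k))" "z = b \<otimes> cj ?h u"
      using split[OF _ az(2)] by auto
    have c: "a \<in> carrier G" "b \<in> carrier G" "u \<in> carrier G"
      using az bu Mc subgroup.subset[OF subA] by blast+
    have "x = a \<otimes> (cj (?h [^] k) b \<otimes> cj (?h [^] k) (cj ?h u))"
      using az(3) bu(3) c h by (simp add: cj_mult)
    then have "x = (a \<otimes> cj (?h [^] k) b) \<otimes> cj (?h [^] Suc k) u"
      using c h cj_pow_Suc(2)[of ?h u k] by (simp add: m_assoc del: nat_pow_Suc)
    moreover have "a \<otimes> cj (?h [^] k) b \<in> M"
      using az(1) M_cj[OF bu(1)] subM by (simp add: subgroup.m_closed)
    ultimately show ?case using bu(2) by auto
  qed
  have "\<exists>a\<in>minus_part ?h (A N). \<exists>b\<in>minus_part g (A N). x = a \<otimes> b" if x: "x \<in> A N" for x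
  proof -
    have xc: "x \<in> carrier G" using x subgroup.subset[OF subA] by blast
    \<comment> \<open>\<open>D k\<close> holds the left factors that work for the first
      \<open>k\<close> conjugations. Each meets \<open>M\<close> by \<open>tele\<close>, and
      compactness of \<open>M\<close> produces one factor that works for all.\<close>
    define D where "D k = (\<Inter>j\<in>{..k}. {a \<in> carrier G. cj (g [^] j) (inv a \<otimes> x) \<in> A N})" for k :: nat
    have "closedin T {a \<in> carrier G. cj (g [^] j) (inv a \<otimes> x) \<in> A N}" for j :: nat
    proof -
      have "continuous_map T T (\<lambda>a. inv a \<otimes> x)"
        using xc by (intro continuous_map_mult continuous_inv) (simp_all add: topspace_eq)
      from continuous_map_compose[OF this continuous_map_cj[of "g [^] j"]]
      have "continuous_map T T (\<lambda>a. cj (g [^] j) (inv a \<otimes> x))"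
        using g by (simp add: o_def)
      from closedin_continuous_map_preimage[OF this compactin_closedin[OF cA]] show ?thesis
        by (simp add: topspace_eq)
    qed
    then have "closedin T (D k)" for k
      unfolding D_def by (intro closedin_INT) auto
    moreover have "M \<inter> D k \<noteq> {}" for k
    proof -
      obtain a z where az: "a \<in> M" "z \<in> A (N + k)" "x = a \<otimes> cj (?h [^] k) z"
        using tele[OF x] by blast
      have c: "a \<in> carrier G" "z \<in> carrier G" "z \<in> C"
        using az Mc subgroup.subset[OF subA] by (auto simp: A_def)
      have "cj (g [^] j) (inv a \<otimes> x) \<in> A N" if "j \<le> k" for j
      proof -
        have eq: "cj (g [^] j) (inv a \<otimes> x) = cj (?h [^] (k - j)) z"
          using az(3) c h cj_pow_inv_le[OF g c(2) that] by simp
        \<comment> \<open>The total exponent \<open>i + (k - j)\<close> is at most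
          \<open>N + k\<close>, which is within the range controlled by
          \<open>z \<in> A (N + k)\<close>.\<close>
        have "cj (?h [^] i) (cj (?h [^] (k - j)) z) \<in> U" if "i \<le> N" for i
          using that az(2) cj_pow_add[OF h c(2), of i "k - j"] by (auto simp: A_def B_def)
        then show ?thesis
          unfolding eq using c h stable_pow by (auto simp: A_def B_def)
      qed
      then show ?thesis using az(1) c by (auto simp: D_def)
    qed
    ultimately have "M \<inter> (\<Inter>k. D k) \<noteq> {}"
      by (intro compactin_nested_Int[OF cM]) (auto simp: D_def)
    then obtain a where aM: "a \<in> M" and aD: "\<And>k. a \<in> D k" by blast
    have a: "a \<in> M" "a \<in> carrier G" "cj (g [^] k) (inv a \<otimes> x) \<in> A N" for k :: nat
      using aM Mc aD[of k] by (auto simp: D_def)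
    have "inv a \<otimes> x \<in> minus_part g (A N)"
      using a xc by (auto simp: minus_part_def)
    moreover have "a \<in> minus_part ?h (A N)"
      using M_cj[OF a(1)] M_A[of N] a(2) by (auto simp: minus_part_def)
    moreover have "x = a \<otimes> (inv a \<otimes> x)" using a xc by simp
    ultimately show ?thesis by blast
  qed
  then have "tidy_above g (B N \<inter> C)" unfolding tidy_above_def A_def by blast
  moreover have "B N \<subseteq> U"
  proof
    fix x assume "x \<in> B N"
    then have "x \<in> carrier G" "cj (?h [^] (0::nat)) x \<in> U" unfolding B_def by blast+
    then show "x \<in> U" by simp
  qed
  ultimately show thesis using that B_compact_open by blast
qed

lemma shadowing:
  assumes U: "compactin T U" "subgroup U G" and tidy: "tidy_above g U" and g: "g \<in> carrier G"
    and F: "F 0 = \<one>" "\<And>n. \<exists>u\<in>U. \<exists>v\<in>U. F (Suc n) = u \<otimes> g \<otimes> v \<otimes> F n"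
  obtains s where "s \<in> minus_part (inv g) U" "\<And>n. F n \<otimes> s \<otimes> inv (g [^] n) \<in> U"
proof -
  have h: "inv g \<in> carrier G" using g by simp
  have Uc: "U \<subseteq> carrier G" using U(2) subgroup.subset by blast
  have Fc: "F n \<in> carrier G" for n
  proof (induction n)
    case (Suc n)
    obtain u v where "u \<in> U" "v \<in> U" "F (Suc n) = u \<otimes> g \<otimes> v \<otimes> F n" using F(2) by blast
    then show ?case using Suc Uc g by (auto simp: subset_iff)
  qed (simp add: F)
  define P where "P = minus_part (inv g) U"
  have subP: "subgroup P G" unfolding P_def using U(2) h by (rule subgroup_minus_part)
  have Pc: "P \<subseteq> carrier G" using subP subgroup.subset by blast
  define S where "S n = (\<Inter>m\<in>{..n}. {s \<in> carrier G. F m \<otimes> s \<otimes> inv (g [^] m) \<in> U})" for n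
  have "closedin T (S n)" for n
    unfolding S_def using U(1) Fc g
    by (intro closedin_INT closedin_translate_vimage compactin_closedin) auto
  moreover have "P \<inter> S n \<noteq> {}" for n
  proof (induction n)
    case 0
    have "\<one> \<in> S 0" using F(1) U(2) by (simp add: S_def subgroup.one_closed)
    then show ?case using subgroup.one_closed[OF subP] by blast
  next
    case (Suc n)
    then obtain s where s: "s \<in> P" "\<And>m. m \<le> n \<Longrightarrow> F m \<otimes> s \<otimes> inv (g [^] m) \<in> U"
      unfolding S_def by auto
    obtain u v where uv: "u \<in> U" "v \<in> U" "F (Suc n) = u \<otimes> g \<otimes> v \<otimes> F n" using F(2) by blast
    have "v \<otimes> (F n \<otimes> s \<otimes> inv (g [^] n)) \<in> U"
      using uv s(2)[of n] U(2) by (simp add: subgroup.m_closed)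
    then obtain b c where bc: "b \<in> minus_part g U" "c \<in> P"
      "v \<otimes> (F n \<otimes> s \<otimes> inv (g [^] n)) = b \<otimes> c"
      using tidy_above_swap[OF tidy U(2) g] unfolding P_def by blast
    have car: "s \<in> carrier G" "u \<in> carrier G" "v \<in> carrier G" "b \<in> carrier G" "c \<in> carrier G"
      using s(1) uv bc Pc Uc by (auto simp: minus_part_carrier)
    \<comment> \<open>The factor \<open>c \<in> U\<^sub>+\<close> obstructs step
      \<open>Suc n\<close>, so its inverse is pulled back by \<open>n\<close> conjugations and
      absorbed into \<open>s\<close>. For \<open>m \<le> n\<close> this changes the condition by
      \<open>cj (inv g [^] (n - m)) (inv c)\<close>, an element of \<open>U\<close>.\<close>
    define d where "d = cj (inv g [^] n) (inv c)"
    have ic: "inv c \<in> P" using bc(2) subP by (simp add: subgroup.m_inv_closed)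
    have d: "d \<in> P" unfolding d_def P_def using ic h unfolding P_def by (rule cj_mem_minus_part)
    have dc: "d \<in> carrier G" using d Pc by blast
    have "F m \<otimes> (s \<otimes> d) \<otimes> inv (g [^] m) \<in> U" if "m \<le> n" for m
    proof -
      have "F m \<otimes> (s \<otimes> d) \<otimes> inv (g [^] m) = (F m \<otimes> s \<otimes> inv (g [^] m)) \<otimes> cj (g [^] m) d"
        using car dc Fc g by (simp add: cj_def m_assoc)
      moreover have "cj (g [^] m) d = cj (inv g [^] (n - m)) (inv c)"
        unfolding d_def using cj_pow_inv_le[OF g _ that] car by simp
      moreover have "cj (inv g [^] (n - m)) (inv c) \<in> U"
        using ic unfolding P_def by (rule minus_partD)
      ultimately show ?thesis using s(2)[OF that] U(2) by (simp add: subgroup.m_closed)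
    qed
    moreover have "F (Suc n) \<otimes> (s \<otimes> d) \<otimes> inv (g [^] Suc n) \<in> U"
    proof -
      have inv_pow: "inv (g [^] Suc n) = inv (g [^] n) \<otimes> inv g"
        using g nat_pow_Suc2[OF g, of n] by (metis inv_mult_group nat_pow_closed)
      have "F (Suc n) \<otimes> (s \<otimes> d) \<otimes> inv (g [^] Suc n)
          = u \<otimes> g \<otimes> (v \<otimes> (F n \<otimes> s \<otimes> inv (g [^] n))) \<otimes> cj (g [^] n) d \<otimes> inv g"
        unfolding inv_pow using uv(3) car dc Fc g by (simp add: cj_def m_assoc)
      also have "cj (g [^] n) d = inv c" unfolding d_def using car g by simp
      \<comment> \<open>The correction cancels \<open>c\<close>; what is left is
        \<open>b \<in> U\<^sub>-\<close>, whose conjugate by \<open>g\<close> stays in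
        \<open>U\<close>.\<close>
      also have "u \<otimes> g \<otimes> (v \<otimes> (F n \<otimes> s \<otimes> inv (g [^] n))) \<otimes> inv c \<otimes> inv g = u \<otimes> cj g b"
        unfolding bc(3) using car g by (simp add: cj_def m_assoc)
      also have "\<dots> \<in> U"
        using uv(1) minus_partD[OF bc(1), of 1] U(2) g by (simp add: subgroup.m_closed)
      finally show ?thesis .
    qed
    ultimately have "s \<otimes> d \<in> S (Suc n)"
      using car dc by (auto simp: S_def le_Suc_eq simp del: nat_pow_Suc)
    moreover have "s \<otimes> d \<in> P" using s(1) d subP by (simp add: subgroup.m_closed)
    ultimately show ?case by blast
  qed
  moreover have "compactin T P" unfolding P_def using U(1) h by (rule compactin_minus_part)
  ultimately have "P \<inter> (\<Inter>n. S n) \<noteq> {}"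
    by (intro compactin_nested_Int) (auto simp: S_def)
  then obtain s where "s \<in> P" and sS: "\<And>n. s \<in> S n" by blast
  have "F n \<otimes> s \<otimes> inv (g [^] n) \<in> U" for n
    using sS[of n] by (auto simp: S_def)
  then show thesis using that \<open>s \<in> P\<close> unfolding P_def by blast
qed

end

section \<open>Contraction modulo a compact group\<close>

context tdlc_group
begin

text \<open>For a compact subgroup \<open>C\<close> this is membership in the contraction group of
  \<open>g\<close> modulo \<open>C\<close>, expressed through neighbourhoods of \<open>C\<close>
  rather than convergence in \<open>G/C\<close>.\<close>

definition attracted :: "'a \<Rightarrow> 'a \<Rightarrow> 'a set \<Rightarrow> bool" where
  "attracted g x C \<longleftrightarrow>
     (\<forall>W. openin T W \<longrightarrow> C \<subseteq> W \<longrightarrow> (\<forall>\<^sub>F n in sequentially. cj (g [^] (n::nat)) x \<in> W))"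

lemma attractedD:
  "\<lbrakk>attracted g x C; openin T W; C \<subseteq> W\<rbrakk> \<Longrightarrow> \<forall>\<^sub>F n in sequentially. cj (g [^] (n::nat)) x \<in> W"
  unfolding attracted_def by blast

lemma con_iff_attracted: "x \<in> con G T g \<longleftrightarrow> x \<in> carrier G \<and> attracted g x {\<one>}"
  unfolding con_def attracted_def limitin_def cj_def by (auto simp: topspace_eq)

definition stable_subgroup :: "'a \<Rightarrow> 'a set \<Rightarrow> bool" where
  "stable_subgroup g C \<longleftrightarrow> subgroup C G \<and> compactin T C \<and>
     (\<forall>x\<in>C. cj g x \<in> C) \<and> (\<forall>x\<in>C. cj (inv g) x \<in> C)"

lemma stable_subgroupD:
  assumes "stable_subgroup g C"
  shows "subgroup C G" "compactin T C" "closedin T C" "C \<subseteq> carrier G" "\<one> \<in> C"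
    "\<And>x. x \<in> C \<Longrightarrow> cj g x \<in> C" "\<And>x. x \<in> C \<Longrightarrow> cj (inv g) x \<in> C"
  using assms subgroup.subset subgroup.one_closed unfolding stable_subgroup_def
  by (blast intro: compactin_closedin)+

lemma stable_subgroup_pow:
  fixes n :: nat
  assumes "stable_subgroup g C" "g \<in> carrier G" "x \<in> C"
  shows "cj (g [^] n) x \<in> C" "cj (inv g [^] n) x \<in> C"
  using assms stable_subgroupD[OF assms(1)] by (auto intro: cj_pow_stable)

text \<open>The union is the product set \<open>N C\<close>, written with right translates of
  \<open>N\<close> so that openness is immediate.\<close>

lemma openin_thickening:
  assumes "compact_open_subgroup N" "C \<subseteq> carrier G"
  shows "openin T (\<Union>c\<in>C. {x \<in> carrier G. x \<otimes> inv c \<in> N})"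
    and "C \<subseteq> (\<Union>c\<in>C. {x \<in> carrier G. x \<otimes> inv c \<in> N})"
proof -
  have "openin T {x \<in> carrier G. x \<otimes> inv c \<in> N}" if "c \<in> C" for c
    using that assms compact_open_subgroupD(2) by (intro openin_r_mult_vimage) auto
  then show "openin T (\<Union>c\<in>C. {x \<in> carrier G. x \<otimes> inv c \<in> N})" by blast
  show "C \<subseteq> (\<Union>c\<in>C. {x \<in> carrier G. x \<otimes> inv c \<in> N})"
    using assms(2) compact_open_subgroupD(5)[OF assms(1)] by force
qed

text \<open>If the orbit of \<open>y\<close> is in \<open>N C\<close>, then so is that of
  \<open>y \<otimes> c\<close>, because \<open>C\<close> is a stable group and absorbs the orbit of
  \<open>c\<close>; and \<open>N C \<subseteq> W\<close> for small \<open>N\<close>.\<close>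

lemma attracted_mult:
  assumes "attracted g y C" "stable_subgroup g C" "g \<in> carrier G" "y \<in> carrier G" "c \<in> C"
  shows "attracted g (y \<otimes> c) C"
  unfolding attracted_def
proof (intro allI impI)
  note C = stable_subgroupD[OF assms(2)]
  fix W assume "openin T W" "C \<subseteq> W"
  then obtain N where N: "compact_open_subgroup N" "\<And>n c. \<lbrakk>n \<in> N; c \<in> C\<rbrakk> \<Longrightarrow> n \<otimes> c \<in> W"
    using tube[OF C(2)] by blast
  have "cj (g [^] n) (y \<otimes> c) \<in> W"
    if *: "cj (g [^] n) y \<in> (\<Union>d\<in>C. {x \<in> carrier G. x \<otimes> inv d \<in> N})" for n :: nat
  proof -
    obtain d where d: "d \<in> C" "cj (g [^] n) y \<otimes> inv d \<in> N" using * by blast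
    have c: "c \<in> carrier G" "d \<in> carrier G" using assms(5) d(1) C(4) by blast+
    have "cj (g [^] n) (y \<otimes> c) = (cj (g [^] n) y \<otimes> inv d) \<otimes> (d \<otimes> cj (g [^] n) c)"
      using assms(3,4) c by (simp add: cj_mult m_assoc)
    moreover have "d \<otimes> cj (g [^] n) c \<in> C"
      using stable_subgroup_pow(1)[OF assms(2,3,5)] d(1) C(1) by (simp add: subgroup.m_closed)
    ultimately show ?thesis using N(2)[OF d(2)] by simp
  qed
  then show "\<forall>\<^sub>F n in sequentially. cj (g [^] n) (y \<otimes> c) \<in> W"
    using attractedD[OF assms(1) openin_thickening[OF N(1) C(4)]] by (rule eventually_mono[rotated])
qed

text \<open>One descent step. The orbit of \<open>y\<close> stays close to points \<open>q n\<close>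
  of \<open>C\<close>, which form an orbit up to errors in a small \<open>V\<close>. Shadowing
  inside \<open>C\<close> replaces it by a true orbit; dividing that out brings \<open>y\<close>
  into \<open>V\<close> eventually, and the attracting group shrinks to the part of \<open>C\<close>
  that never leaves \<open>V\<close>.\<close>

lemma attracted_refine:
  assumes C: "stable_subgroup g C" and g: "g \<in> carrier G" and y: "y \<in> carrier G" "attracted g y C"
    and c0: "c0 \<in> C" "c0 \<noteq> \<one>"
  obtains c C' where "c \<in> C" "stable_subgroup g C'" "C' \<subseteq> C" "c0 \<notin> C'" "attracted g (y \<otimes> c) C'"
proof -
  note CD = stable_subgroupD[OF C]
  have h: "inv g \<in> carrier G" using g by simp
  have "closedin T {c0}" using c0 CD(4) Hausdorff
    by (metis closedin_Hausdorff_sing_eq subsetD topspace_eq)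
  then have "openin T (topspace T - {c0})" by blast
  then obtain U where U: "compact_open_subgroup U" "U \<subseteq> topspace T - {c0}"
    using van_dantzig[of "topspace T - {c0}"] c0(2) topspace_eq by auto
  obtain V where V: "compact_open_subgroup V" "V \<subseteq> U" "tidy_above g (V \<inter> C)"
    using exists_tidy_above[OF U(1) CD(1,3) g CD(6,7)] by blast
  have subV: "subgroup V G" by (rule compact_open_subgroupD(1)[OF V(1)])
  have subO: "subgroup (V \<inter> C) G" using subV CD(1) by (rule subgroups_Inter_pair)
  have cO: "compactin T (V \<inter> C)"
    using compact_open_subgroupD(4)[OF V(1)] CD(2) by (rule closed_Int_compactin)
  \<comment> \<open>Both \<open>E\<close> and its conjugate by \<open>g\<close> lie in
    \<open>V\<close>, so the discrepancy between \<open>q (Suc n)\<close> and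
    \<open>cj g (q n)\<close> lies in \<open>V\<close> as well.\<close>
  define E where "E = V \<inter> {x \<in> carrier G. cj g x \<in> V}"
  have E: "compact_open_subgroup E" unfolding E_def using V(1) g
    by (intro compact_open_subgroup_Int compact_open_subgroup_cj_vimage)
  obtain N :: nat where N: "\<forall>n\<ge>N. cj (g [^] n) y \<in> (\<Union>d\<in>C. {x \<in> carrier G. x \<otimes> inv d \<in> E})"
    using attractedD[OF y(2) openin_thickening[OF E CD(4)]] unfolding eventually_sequentially
    by blast
  then have "\<forall>n. \<exists>d. n \<ge> N \<longrightarrow> d \<in> C \<and> cj (g [^] n) y \<otimes> inv d \<in> E" by blast
  then obtain q where q: "\<And>n. n \<ge> N \<Longrightarrow> q n \<in> C" "\<And>n. n \<ge> N \<Longrightarrow> cj (g [^] n) y \<otimes> inv (q n) \<in> E"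
    by metis
  have qc: "q n \<in> carrier G" if "n \<ge> N" for n using q(1)[OF that] CD(4) by blast
  \<comment> \<open>The drift of \<open>q\<close> relative to the motion by \<open>g\<close>,
    started at \<open>N\<close>: each step multiplies on the left by \<open>u \<otimes> g\<close>
    with \<open>u \<in> V \<inter> C\<close> the discrepancy.\<close>
  define F where "F n = q (N + n) \<otimes> g [^] n \<otimes> inv (q N)" for n
  have Fc: "F n \<in> carrier G" for n unfolding F_def using qc g by simp
  have "F 0 = \<one>" using qc by (simp add: F_def)
  moreover have "\<exists>u\<in>V \<inter> C. \<exists>v\<in>V \<inter> C. F (Suc n) = u \<otimes> g \<otimes> v \<otimes> F n" for n
  proof -
    let ?m = "N + n"
    let ?q = "q ?m" and ?q' = "q (Suc ?m)"
    have cc: "?q \<in> carrier G" "?q' \<in> carrier G" "q N \<in> carrier G" "g [^] n \<in> carrier G"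
      using qc g by simp_all
    define u where "u = ?q' \<otimes> inv (cj g ?q)"
    define w where "w = cj (g [^] ?m) y \<otimes> inv ?q"
    define w' where "w' = cj (g [^] Suc ?m) y \<otimes> inv ?q'"
    have w: "w \<in> E" "w' \<in> E" unfolding w_def w'_def using q(2)[of ?m] q(2)[of "Suc ?m"] by simp_all
    have "cj g w = cj (g [^] Suc ?m) y \<otimes> inv (cj g ?q)"
      unfolding w_def using cj_pow_Suc(1)[OF g y(1), of ?m] cc g y(1)
      by (simp add: cj_mult cj_inv del: nat_pow_Suc)
    then have "u = inv w' \<otimes> cj g w"
      unfolding u_def w'_def using cc g y(1) by (simp add: m_assoc inv_mult_group del: nat_pow_Suc)
    then have "u \<in> V"
      using w subV unfolding E_def by (simp add: subgroup.m_closed subgroup.m_inv_closed)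
    moreover have "u \<in> C"
      unfolding u_def using q(1)[of ?m] q(1)[of "Suc ?m"] CD(1,6)
      by (simp add: subgroup.m_closed subgroup.m_inv_closed)
    moreover have "F (Suc n) = u \<otimes> g \<otimes> \<one> \<otimes> F n"
    proof -
      have "F (Suc n) = ?q' \<otimes> (g \<otimes> g [^] n) \<otimes> inv (q N)"
        unfolding F_def using nat_pow_Suc2[OF g, of n] by simp
      then show ?thesis
        unfolding F_def u_def using cc g by (simp add: cj_def m_assoc inv_mult_group)
    qed
    ultimately show ?thesis using subgroup.one_closed[OF subO] by blast
  qed
  ultimately obtain s where s: "s \<in> minus_part (inv g) (V \<inter> C)"
    "\<And>n. F n \<otimes> s \<otimes> inv (g [^] n) \<in> V \<inter> C"
    using shadowing[OF cO subO V(3) g, of F] by blast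
  have sC: "s \<in> C" "s \<in> carrier G" using s(1) minus_part_subset[of "inv g" "V \<inter> C"] CD(4) by auto
  \<comment> \<open>Chosen so that \<open>cj (g [^] (N + n)) c\<close> is
    \<open>inv (q (N + n))\<close> times an element of \<open>V\<close>; this cancels
    \<open>q\<close> in the orbit of \<open>y\<close>.\<close>
  define c where "c = cj (inv g [^] N) (inv (q N) \<otimes> s)"
  have qs: "inv (q N) \<otimes> s \<in> C"
    using q(1)[of N] sC CD(1) by (simp add: subgroup.m_closed subgroup.m_inv_closed)
  have cC: "c \<in> C" unfolding c_def using stable_subgroup_pow(2)[OF C g qs] .
  have cc: "c \<in> carrier G" using cC CD(4) by blast
  define z where "z = y \<otimes> c"
  have zc: "z \<in> carrier G" using y cc by (simp add: z_def)
  have zV: "cj (g [^] m) z \<in> V" if m: "m \<ge> N" for m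
  proof -
    obtain n where n: "m = N + n" using m le_Suc_ex by blast
    have "cj (g [^] m) c = cj (g [^] n) (cj (g [^] N) c)"
      using cj_pow_add[OF g cc, of n N] by (simp add: n add.commute)
    also have "\<dots> = cj (g [^] n) (inv (q N) \<otimes> s)"
      unfolding c_def using g qc[of N] sC by simp
    also have "\<dots> = inv (q m) \<otimes> (F n \<otimes> s \<otimes> inv (g [^] n))"
      unfolding F_def n using g qc sC by (simp add: cj_def m_assoc)
    finally have "cj (g [^] m) z = (cj (g [^] m) y \<otimes> inv (q m)) \<otimes> (F n \<otimes> s \<otimes> inv (g [^] n))"
      unfolding z_def using g y cc qc[OF m] sC Fc by (simp add: cj_mult m_assoc)
    moreover have "cj (g [^] m) y \<otimes> inv (q m) \<in> V" using q(2)[OF m] by (simp add: E_def)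
    ultimately show ?thesis using s(2)[of n] subV by (simp add: subgroup.m_closed)
  qed
  have zC: "attracted g z C" unfolding z_def using attracted_mult[OF y(2) C g y(1) cC] .
  \<comment> \<open>The elements of \<open>C\<close> whose whole two-sided orbit under
    \<open>g\<close> stays in \<open>V\<close>; \<open>c0\<close> is excluded because
    \<open>V\<close> avoids it.\<close>
  define C' where "C' = minus_part g (V \<inter> C) \<inter> minus_part (inv g) (V \<inter> C)"
  have "subgroup C' G"
    unfolding C'_def using subgroup_minus_part[OF subO] g h by (intro subgroups_Inter_pair) auto
  moreover have "compactin T C'"
    unfolding C'_def using compactin_minus_part[OF cO] g h
    by (intro closed_Int_compactin compactin_closedin) auto
  moreover have "cj g x \<in> C'" if "x \<in> C'" for x
    using that cj_mem_core[of x g] g unfolding C'_def by blast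
  moreover have "cj (inv g) x \<in> C'" if "x \<in> C'" for x
    using that cj_mem_core[of x "inv g"] g h unfolding C'_def by auto
  ultimately have "stable_subgroup g C'" unfolding stable_subgroup_def by blast
  moreover have C'_sub: "C' \<subseteq> V \<inter> C" unfolding C'_def using minus_part_subset by blast
  moreover have "c0 \<notin> C'" using C'_sub V(2) U(2) by blast
  moreover have "attracted g z C'"
    unfolding attracted_def
  proof (intro allI impI)
    fix W assume W: "openin T W" "C' \<subseteq> W"
    \<comment> \<open>\<open>B m\<close> tests the exponents from \<open>-m\<close> to
      \<open>m\<close> only. The sets \<open>C \<inter> B m\<close> decrease into \<open>C'\<close>,
      so one of them already lies in \<open>W\<close>.\<close>
    define B where "B m = (\<Inter>k\<in>{..m}. {x \<in> carrier G. cj (g [^] k) x \<in> V} \<inter>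
       {x \<in> carrier G. cj (inv g [^] k) x \<in> V})" for m :: nat
    have clB: "closedin T (B m)" for m
      unfolding B_def using compact_open_subgroupD(4)[OF V(1)] g h
      by (intro closedin_INT closedin_Int closedin_cj_vimage) auto
    have "x \<in> C'" if "x \<in> (\<Inter>m. C \<inter> B m)" for x
    proof -
      have x: "x \<in> C" "x \<in> carrier G" "cj (g [^] k) x \<in> V" "cj (inv g [^] k) x \<in> V" for k :: nat
        using that CD(4) unfolding B_def by auto
      then show ?thesis
        using stable_subgroup_pow[OF C g x(1)] unfolding C'_def minus_part_def by blast
    qed
    then have "(\<Inter>m. C \<inter> B m) \<subseteq> W" using W(2) by blast
    moreover have "compactin T (C \<inter> B m)" for m
      using CD(2) clB by (rule compact_Int_closedin)
    moreover have "C \<inter> B (Suc m) \<subseteq> C \<inter> B m" for m by (auto simp: B_def)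
    ultimately obtain m where m: "C \<inter> B m \<subseteq> W"
      using compactin_nested_subset[of T "\<lambda>m. C \<inter> B m" W] Hausdorff W(1) by blast
    \<comment> \<open>Attraction to \<open>C\<close> gives only this larger neighbourhood. From
      exponent \<open>N + m\<close> on, the orbit of \<open>z\<close> is in \<open>B m\<close>,
      since moving back by at most \<open>m\<close> stays beyond \<open>N\<close>; hence it is in
      \<open>W\<close>.\<close>
    have "openin T (W \<union> (topspace T - B m))" using W(1) clB by blast
    moreover have "C \<subseteq> W \<union> (topspace T - B m)" using m CD(4) topspace_eq by blast
    ultimately have "\<forall>\<^sub>F n in sequentially. cj (g [^] n) z \<in> W \<union> (topspace T - B m)"
      by (rule attractedD[OF zC])
    moreover have "\<forall>\<^sub>F n in sequentially. N + m \<le> n" by (rule eventually_ge_at_top)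
    ultimately show "\<forall>\<^sub>F n in sequentially. cj (g [^] n) z \<in> W"
    proof eventually_elim
      case (elim n)
      have "cj (g [^] k) (cj (g [^] n) z) \<in> V" for k :: nat
        using zV[of "k + n"] cj_pow_add[OF g zc, of k n] elim(2) by simp
      moreover have "cj (inv g [^] k) (cj (g [^] n) z) \<in> V" if "k \<le> m" for k :: nat
        using zV[of "n - k"] cj_pow_inv_le[OF h zc, of k n] elim(2) that g by simp
      ultimately have "cj (g [^] n) z \<in> B m" using zc g by (auto simp: B_def)
      then show ?case using elim(1) by blast
    qed
  qed
  ultimately show thesis using that cC unfolding z_def by blast
qed

text \<open>Zorn's lemma replaces the usual induction along a countable base at the identity, which is
  not available when \<open>T\<close> is not metrizable; it is applied to cosets rather than to subgroups so
  that the correcting factor survives limits.\<close>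

lemma attracted_imp_con:
  assumes Q: "stable_subgroup g Q" and g: "g \<in> carrier G" and x: "x \<in> carrier G" "attracted g x Q"
  obtains q where "q \<in> Q" "x \<otimes> q \<in> con G T g"
proof -
  note QD = stable_subgroupD[OF Q]
  \<comment> \<open>\<open>q\<close> is a partial correction of \<open>x\<close> and
    \<open>C\<close> the ambiguity that remains; the aim is \<open>C = {\<one>}\<close>.\<close>
  define good where "good q C \<longleftrightarrow>
    q \<in> Q \<and> C \<subseteq> Q \<and> stable_subgroup g C \<and> attracted g (x \<otimes> q) C" for q C
  define \<S> where "\<S> = {q <# C | q C. good q C}"
  have coset_iff: "y \<in> q <# C \<longleftrightarrow> inv q \<otimes> y \<in> C"
    if "good q C" "y \<in> carrier G" for q C y
  proof -
    have "q \<in> carrier G" "C \<subseteq> carrier G" using that QD(4) unfolding good_def by blast+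
    then show ?thesis using that(2) by (force simp: l_coset_def)
  qed
  have coset_Q: "q <# C \<subseteq> Q" if "good q C" for q C
    using that QD(1) unfolding good_def l_coset_def by (auto intro: subgroup.m_closed)
  \<comment> \<open>Any point of a good coset is an equally good representative, by
    \<open>attracted_mult\<close>. Cosets can therefore be re-based at a common point.\<close>
  have move: "good p C \<and> p <# C = q <# C" if qC: "good q C" "p \<in> q <# C" for p q C
  proof -
    have C: "stable_subgroup g C" using qC good_def by blast
    note CD = stable_subgroupD[OF C]
    have q: "q \<in> carrier G" using qC(1) QD(4) unfolding good_def by blast
    obtain c where c: "c \<in> C" "p = q \<otimes> c" using qC(2) unfolding l_coset_def by blast
    have cc: "c \<in> carrier G" using c CD(4) by blast
    have "attracted g ((x \<otimes> q) \<otimes> c) C"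
      using qC(1) q x(1) unfolding good_def by (intro attracted_mult[OF _ C g _ c(1)]) auto
    then have "attracted g (x \<otimes> p) C" using x(1) q cc c(2) by (simp add: m_assoc)
    then have gp: "good p C" using qC coset_Q[OF qC(1)] unfolding good_def by blast
    have p: "p \<in> carrier G" using gp QD(4) unfolding good_def by blast
    have "inv p \<otimes> y \<in> C \<longleftrightarrow> inv q \<otimes> y \<in> C" if y: "y \<in> carrier G" for y
    proof -
      have 1: "inv p \<otimes> y = inv c \<otimes> (inv q \<otimes> y)"
        unfolding c(2) using q cc y by (simp add: inv_mult_group m_assoc)
      have 2: "inv q \<otimes> y = c \<otimes> (inv p \<otimes> y)"
        unfolding 1 using q cc y by simp
      show ?thesis
        using 1 2 c(1) CD(1) by (metis subgroup.m_closed subgroup.m_inv_closed)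
    qed
    moreover have "p <# C \<subseteq> carrier G" "q <# C \<subseteq> carrier G"
      using coset_Q qC(1) gp QD(4) by blast+
    ultimately have "p <# C = q <# C"
      using coset_iff[OF gp] coset_iff[OF qC(1)] by blast
    then show ?thesis using gp by blast
  qed
  have self: "q \<in> q <# C" if "good q C" for q C
    using that coset_iff[OF that, of q] QD(4) stable_subgroupD(5)[of g C] unfolding good_def by auto
  have inj: "C \<subseteq> D" if "good p C" "good p D" "p <# C \<subseteq> p <# D" for p C D
  proof
    fix d assume d: "d \<in> C"
    have c: "p \<in> carrier G" "d \<in> carrier G"
      using that(1) d QD(4) unfolding good_def by blast+
    have "p \<otimes> d \<in> p <# D" using d that(3) unfolding l_coset_def by blast
    then show "d \<in> D" using coset_iff[OF that(2)] c by simp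
  qed
  have "partial_order_on \<S> (relation_of (\<lambda>A B. B \<subseteq> A) \<S>)"
    by (rule partial_order_on_relation_ofI) auto
  moreover have "\<exists>u\<in>\<S>. \<forall>a\<in>\<C>. u \<subseteq> a" if ch: "\<C> \<in> Chains (relation_of (\<lambda>A B. B \<subseteq> A) \<S>)" for \<C>
  proof (cases "\<C> = {}")
    case True
    have "good \<one> Q" using Q x QD(5) unfolding good_def by simp
    then show ?thesis using True unfolding \<S>_def by blast
  next
    case False
    have sub: "\<C> \<subseteq> \<S>" and lin: "\<And>A B. \<lbrakk>A \<in> \<C>; B \<in> \<C>\<rbrakk> \<Longrightarrow> A \<subseteq> B \<or> B \<subseteq> A"
      using ch unfolding Chains_def relation_of_def by blast+
    have cpt: "compactin T A" if AS: "A \<in> \<S>" for A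
    proof -
      obtain q C where A: "A = q <# C" "good q C" using AS unfolding \<S>_def by blast
      then have "q \<in> carrier G" "compactin T C"
        using QD(4) stable_subgroupD(2)[of g C] unfolding good_def by blast+
      moreover have "q <# C = (\<lambda>c. q \<otimes> c) ` C" unfolding l_coset_def by blast
      ultimately show ?thesis using A image_compactin[OF _ continuous_map_l_mult] by metis
    qed
    have "\<not> A \<subseteq> {}" if "A \<in> \<C>" for A
      using that sub self unfolding \<S>_def by blast
    \<comment> \<open>With \<open>W = {}\<close>, the chain lemma shows that a chain of nonempty
      compact cosets has a common point \<open>p\<close>. Re-based at \<open>p\<close>, the chain
      becomes a chain of subgroups, and their intersection is a lower bound.\<close>
    then have "\<not> \<Inter>\<C> \<subseteq> {}"
      using compactin_chain_Int_subset[OF False cpt[OF subsetD[OF sub]] Hausdorff lin openin_empty]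
      by blast
    then obtain p where p: "\<And>A. A \<in> \<C> \<Longrightarrow> p \<in> A" by blast
    define \<D> where "\<D> = {C. good p C \<and> p <# C \<in> \<C>}"
    have cover: "\<exists>C\<in>\<D>. A = p <# C" if AC: "A \<in> \<C>" for A
    proof -
      obtain q C where A: "A = q <# C" "good q C" using AC sub unfolding \<S>_def by blast
      then have "good p C" "A = p <# C" using move[OF A(2), of p] p[OF AC] by simp_all
      then show ?thesis using AC unfolding \<D>_def by (intro bexI[of _ C]) simp_all
    qed
    then have Dne: "\<D> \<noteq> {}" using False by blast
    have DS: "stable_subgroup g C" if "C \<in> \<D>" for C using that unfolding \<D>_def good_def by blast
    have "good p (\<Inter>\<D>)"
      unfolding good_def
    proof (intro conjI)
      obtain C0 where C0: "C0 \<in> \<D>" using Dne by blast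
      show "p \<in> Q" "\<Inter>\<D> \<subseteq> Q" using C0 unfolding \<D>_def good_def by blast+
      show "stable_subgroup g (\<Inter>\<D>)"
        unfolding stable_subgroup_def
      proof (intro conjI ballI)
        show "subgroup (\<Inter>\<D>) G"
          by (intro subgroups_Inter Dne stable_subgroupD(1)[OF DS])
        show "compactin T (\<Inter>\<D>)"
        proof (rule closed_compactin)
          show "compactin T C0" using stable_subgroupD(2)[OF DS[OF C0]] .
          show "\<Inter>\<D> \<subseteq> C0" using C0 by blast
          show "closedin T (\<Inter>\<D>)"
            by (intro closedin_Inter Dne stable_subgroupD(3)[OF DS])
        qed
        show "cj g d \<in> \<Inter>\<D>" "cj (inv g) d \<in> \<Inter>\<D>" if "d \<in> \<Inter>\<D>" for d
          using that stable_subgroupD(6,7)[OF DS] by blast+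
      qed
      show "attracted g (x \<otimes> p) (\<Inter>\<D>)"
        unfolding attracted_def
      proof (intro allI impI)
        fix W assume W: "openin T W" "\<Inter>\<D> \<subseteq> W"
        have D_lin: "A \<subseteq> B \<or> B \<subseteq> A" if "A \<in> \<D>" "B \<in> \<D>" for A B
          using lin[of "p <# A" "p <# B"] inj[of p A B] inj[of p B A] that unfolding \<D>_def by blast
        have "\<exists>C\<in>\<D>. C \<subseteq> W"
          by (rule compactin_chain_Int_subset[OF Dne stable_subgroupD(2)[OF DS] Hausdorff D_lin W])
        then obtain C where C: "C \<in> \<D>" "C \<subseteq> W" by blast
        then have "attracted g (x \<otimes> p) C" unfolding \<D>_def good_def by blast
        then show "\<forall>\<^sub>F n in sequentially. cj (g [^] n) (x \<otimes> p) \<in> W"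
          using W(1) C(2) by (rule attractedD)
      qed
    qed
    moreover have "p <# \<Inter>\<D> \<subseteq> A" if "A \<in> \<C>" for A
      using cover[OF that] unfolding l_coset_def by blast
    ultimately show ?thesis unfolding \<S>_def by blast
  qed
  ultimately have "\<exists>M\<in>\<S>. \<forall>A\<in>\<S>. A \<subseteq> M \<longrightarrow> A = M"
    by (rule predicate_Zorn)
  then obtain M where M: "M \<in> \<S>" and min: "\<And>A. \<lbrakk>A \<in> \<S>; A \<subseteq> M\<rbrakk> \<Longrightarrow> A = M" by blast
  obtain q C where q: "M = q <# C" "good q C" using M unfolding \<S>_def by blast
  have C: "stable_subgroup g C" using q(2) good_def by blast
  note CD = stable_subgroupD[OF C]
  have qc: "q \<in> Q" "q \<in> carrier G" "x \<otimes> q \<in> carrier G" "attracted g (x \<otimes> q) C"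
    using q(2) QD(4) x(1) unfolding good_def by auto
  \<comment> \<open>Otherwise refinement yields a good coset inside \<open>M\<close> whose subgroup
    omits \<open>c0\<close>. Minimality makes the two cosets equal, which forces
    \<open>C \<subseteq> C'\<close>.\<close>
  have "C = {\<one>}"
  proof (rule ccontr)
    assume "C \<noteq> {\<one>}"
    then obtain c0 where "c0 \<in> C" "c0 \<noteq> \<one>" using CD(5) by blast
    then obtain c C' where c: "c \<in> C" "stable_subgroup g C'" "C' \<subseteq> C" "c0 \<notin> C'"
      "attracted g (x \<otimes> q \<otimes> c) C'"
      using attracted_refine[OF C g qc(3,4)] by metis
    have cc: "c \<in> carrier G" using c(1) CD(4) by blast
    have gp: "good (q \<otimes> c) C'"
      using c qc cc q(2) x(1) QD(1) unfolding good_def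
      by (auto simp: m_assoc intro: subgroup.m_closed)
    have "(q \<otimes> c) <# C' \<subseteq> M"
    proof
      fix y assume "y \<in> (q \<otimes> c) <# C'"
      then obtain d where d: "d \<in> C'" "y = q \<otimes> c \<otimes> d" unfolding l_coset_def by blast
      then have "y = q \<otimes> (c \<otimes> d)" "c \<otimes> d \<in> C"
        using c CD(1,4) qc by (auto simp: subset_iff m_assoc intro: subgroup.m_closed)
      then show "y \<in> M" unfolding q(1) l_coset_def by blast
    qed
    then have eq: "(q \<otimes> c) <# C' = q <# C" using min gp q(1) unfolding \<S>_def by blast
    then have "q \<in> (q \<otimes> c) <# C'" using self[OF q(2)] by simp
    then have "q <# C' = (q \<otimes> c) <# C'" "good q C'" using move[OF gp] by blast+
    then have "C \<subseteq> C'" using inj[OF q(2)] eq by auto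
    then show False using \<open>c0 \<in> C\<close> c(4) by blast
  qed
  then show thesis using that qc by (auto simp: con_iff_attracted)
qed

end

section \<open>Perturbing the contracting element\<close>

context tdlc_group
begin

section \<open>Contraction groups under powers, conjugation and shadowing\<close>

lemma con_carrier: "con G T g \<subseteq> carrier G"
  by (auto simp: con_def)

lemma conI:
  assumes "x \<in> carrier G"
    and "\<And>W. \<lbrakk>openin T W; \<one> \<in> W\<rbrakk> \<Longrightarrow> \<exists>N. \<forall>n\<ge>N. cj (g [^] (n::nat)) x \<in> W"
  shows "x \<in> con G T g"
  using assms unfolding con_iff_attracted attracted_def eventually_sequentially by simp

lemma conD:
  assumes "x \<in> con G T g" "openin T W" "\<one> \<in> W"
  obtains N where "\<And>n. n \<ge> N \<Longrightarrow> cj (g [^] (n::nat)) x \<in> W"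
  using assms unfolding con_iff_attracted attracted_def eventually_sequentially by auto

lemma con_pow:
  fixes n :: nat
  assumes g: "g \<in> carrier G" and n: "n > 0"
  shows "con G T (g [^] n) = con G T g"
proof (intro subset_antisym subsetI)
  fix x assume x: "x \<in> con G T g"
  then have xc: "x \<in> carrier G" using con_carrier by blast
  show "x \<in> con G T (g [^] n)"
  proof (rule conI[OF xc])
    fix W assume "openin T W" "\<one> \<in> W"
    then obtain N where N: "\<And>m. m \<ge> N \<Longrightarrow> cj (g [^] (m::nat)) x \<in> W" using conD[OF x] by blast
    have "cj ((g [^] n) [^] m) x \<in> W" if "m \<ge> N" for m :: nat
    proof -
      have "N \<le> n * m" using that n by (metis le_trans mult_le_mono1 nat_mult_1 Suc_leI One_nat_def)
      then show ?thesis using N[of "n * m"] g by (simp add: nat_pow_pow)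
    qed
    then show "\<exists>N. \<forall>m\<ge>N. cj ((g [^] n) [^] (m::nat)) x \<in> W" by blast
  qed
next
  fix x assume x: "x \<in> con G T (g [^] n)"
  then have xc: "x \<in> carrier G" using con_carrier by blast
  show "x \<in> con G T g"
  proof (rule conI[OF xc])
    fix W assume W: "openin T W" "\<one> \<in> W"
    \<comment> \<open>\<open>W'\<close> takes care of the finitely many remainders
      \<open>r < n\<close> that an exponent can leave on division by \<open>n\<close>.\<close>
    define W' where "W' = carrier G \<inter> (\<Inter>r\<in>{..<n}. {y \<in> carrier G. cj (g [^] r) y \<in> W})"
    have "openin T W'"
      unfolding W'_def using W(1) g openin_topspace[of T] topspace_eq
      by (intro openin_Int_Inter) (auto intro!: openin_cj_vimage)
    moreover have "\<one> \<in> W'" using W(2) g by (simp add: W'_def)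
    ultimately obtain N where N: "\<And>m. m \<ge> N \<Longrightarrow> cj ((g [^] n) [^] (m::nat)) x \<in> W'"
      using conD[OF x] by blast
    have "cj (g [^] m) x \<in> W" if m: "m \<ge> n * N" for m :: nat
    proof -
      have "m div n \<ge> N" using m n by (simp add: less_eq_div_iff_mult_less_eq mult.commute)
      then have "cj ((g [^] n) [^] (m div n)) x \<in> W'" by (rule N)
      moreover have "m mod n < n" using n by simp
      ultimately have "cj (g [^] (m mod n)) (cj ((g [^] n) [^] (m div n)) x) \<in> W"
        unfolding W'_def by blast
      then show ?thesis
        using cj_pow_add[OF g xc, of "m mod n" "n * (m div n)"] g by (simp add: nat_pow_pow)
    qed
    then show "\<exists>N. \<forall>m\<ge>N. cj (g [^] (m::nat)) x \<in> W" by blast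
  qed
qed

lemma cj_mem_con:
  assumes "a \<in> carrier G" "g \<in> carrier G" "x \<in> con G T g"
  shows "cj a x \<in> con G T (cj a g)"
proof (rule conI)
  have xc: "x \<in> carrier G" using assms con_carrier by blast
  then show "cj a x \<in> carrier G" using assms by simp
  fix W assume W: "openin T W" "\<one> \<in> W"
  then obtain N where N: "\<And>n. n \<ge> N \<Longrightarrow> cj (g [^] (n::nat)) x \<in> {y \<in> carrier G. cj a y \<in> W}"
    using conD[OF assms(3) openin_cj_vimage[OF W(1) assms(1)]] assms(1) by auto
  have "cj (cj a g [^] n) (cj a x) = cj a (cj (g [^] n) x)" for n :: nat
    using assms xc by (simp flip: cj_pow) (simp add: cj_def m_assoc inv_mult_group)
  then show "\<exists>N. \<forall>n\<ge>N. cj (cj a g [^] (n::nat)) (cj a x) \<in> W"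
    using N by auto
qed

lemma con_cj:
  assumes "a \<in> carrier G" "g \<in> carrier G"
  shows "con G T (cj a g) = cj a ` con G T g"
proof
  show "cj a ` con G T g \<subseteq> con G T (cj a g)" using assms cj_mem_con by blast
  show "con G T (cj a g) \<subseteq> cj a ` con G T g"
  proof
    fix x assume x: "x \<in> con G T (cj a g)"
    then have xc: "x \<in> carrier G" using con_carrier by blast
    have "cj (inv a) x \<in> con G T g"
      using cj_mem_con[of "inv a" "cj a g" x] assms x by simp
    moreover have "x = cj a (cj (inv a) x)" using assms xc by simp
    ultimately show "x \<in> cj a ` con G T g" by (rule rev_image_eqI)
  qed
qed

text \<open>The orbit of \<open>cj s y\<close> under \<open>f\<close> is the orbit of
  \<open>y\<close> under \<open>g\<close> conjugated by elements of the compact group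
  \<open>U\<close>. By uniform conjugation both converge to \<open>\<one>\<close> or neither
  does.\<close>

lemma con_of_shadow:
  assumes U: "compact_open_subgroup U" and c: "f \<in> carrier G" "g \<in> carrier G" "s \<in> carrier G"
    and b: "\<And>n::nat. f [^] n \<otimes> s \<otimes> inv (g [^] n) \<in> U"
  shows "con G T f = cj s ` con G T g"
proof -
  define b where "b n = f [^] n \<otimes> s \<otimes> inv (g [^] n)" for n :: nat
  have bU: "b n \<in> U" "inv (b n) \<in> U" "b n \<in> carrier G" for n
    using b compact_open_subgroupD(1,6)[OF U] unfolding b_def by (auto simp: subgroup.m_inv_closed)
  have eq: "cj (f [^] n) (cj s y) = cj (b n) (cj (g [^] n) y)" if "y \<in> carrier G" for n y
    using c that unfolding b_def by (simp add: cj_def m_assoc inv_mult_group)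
  have eq': "cj (g [^] n) y = cj (inv (b n)) (cj (f [^] n) (cj s y))" if "y \<in> carrier G" for n y
    using eq[OF that] bU(3) c that by simp
  have "cj s y \<in> con G T f \<longleftrightarrow> y \<in> con G T g" if y: "y \<in> carrier G" for y
  proof
    assume yg: "y \<in> con G T g"
    show "cj s y \<in> con G T f"
    proof (rule conI)
      fix W assume "openin T W" "\<one> \<in> W"
      then obtain M where M: "compact_open_subgroup M" "\<And>m d. \<lbrakk>m \<in> M; d \<in> U\<rbrakk> \<Longrightarrow> cj d m \<in> W"
        using uniform_conjugation[OF compact_open_subgroupD(3)[OF U]] by blast
      obtain N where "\<And>n. n \<ge> N \<Longrightarrow> cj (g [^] (n::nat)) y \<in> M"
        using conD[OF yg] compact_open_subgroupD(2,5)[OF M(1)] by blast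
      then show "\<exists>N. \<forall>n\<ge>N. cj (f [^] (n::nat)) (cj s y) \<in> W"
        using M(2) bU(1) eq[OF y] by metis
    qed (use c y in simp)
  next
    assume yf: "cj s y \<in> con G T f"
    show "y \<in> con G T g"
    proof (rule conI[OF y])
      fix W assume "openin T W" "\<one> \<in> W"
      then obtain M where M: "compact_open_subgroup M" "\<And>m d. \<lbrakk>m \<in> M; d \<in> U\<rbrakk> \<Longrightarrow> cj d m \<in> W"
        using uniform_conjugation[OF compact_open_subgroupD(3)[OF U]] by blast
      obtain N where "\<And>n. n \<ge> N \<Longrightarrow> cj (f [^] (n::nat)) (cj s y) \<in> M"
        using conD[OF yf] compact_open_subgroupD(2,5)[OF M(1)] by blast
      then show "\<exists>N. \<forall>n\<ge>N. cj (g [^] (n::nat)) y \<in> W"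
        using M(2) bU(2) eq'[OF y] by metis
    qed
  qed
  note iff = this
  show ?thesis
  proof
    show "cj s ` con G T g \<subseteq> con G T f" using iff con_carrier by blast
    show "con G T f \<subseteq> cj s ` con G T g"
    proof
      fix x assume x: "x \<in> con G T f"
      then have xc: "x \<in> carrier G" using con_carrier by blast
      have "x = cj s (cj (inv s) x)" using c xc by simp
      moreover have "cj (inv s) x \<in> con G T g" using iff[of "cj (inv s) x"] x xc c by simp
      ultimately show "x \<in> cj s ` con G T g" by (rule image_eqI)
    qed
  qed
qed

text \<open>The conjugates of the compact group \<open>minus_part h U\<close> by powers of
  \<open>h\<close> decrease, and their intersection lies in the two-sided core. They are therefore
  eventually inside any neighbourhood of it.\<close>

lemma attracted_core:
  assumes U: "compact_open_subgroup U" and h: "h \<in> carrier G" and s: "s \<in> minus_part h U"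
  shows "attracted h s (minus_part h U \<inter> minus_part (inv h) U)"
  unfolding attracted_def
proof (intro allI impI)
  fix W assume W: "openin T W" "minus_part h U \<inter> minus_part (inv h) U \<subseteq> W"
  define P where "P = minus_part h U"
  define A where "A n = cj (h [^] n) ` P" for n :: nat
  have Pc: "P \<subseteq> carrier G" unfolding P_def using minus_part_carrier by blast
  have P1: "cj h x \<in> P" if "x \<in> P" for x
    using cj_mem_minus_part[of x h U 1] that h by (simp add: P_def)
  have mono: "A (Suc n) \<subseteq> A n" for n
  proof
    fix y assume "y \<in> A (Suc n)"
    then obtain x where x: "x \<in> P" "y = cj (h [^] Suc n) x" unfolding A_def by blast
    then have "y = cj (h [^] n) (cj h x)" using cj_pow_Suc(2)[OF h, of x n] Pc by blast
    then show "y \<in> A n" using P1[OF x(1)] unfolding A_def by blast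
  qed
  have "compactin T (A n)" for n
    unfolding A_def P_def using compactin_minus_part[OF compact_open_subgroupD(3)[OF U] h] h
    by (intro compactin_cj_image) auto
  moreover have "(\<Inter>n. A n) \<subseteq> W"
  proof
    fix x assume x: "x \<in> (\<Inter>n. A n)"
    have "x \<in> A 0" using x by blast
    then have xP: "x \<in> P" using Pc unfolding A_def by auto
    have "cj (inv h [^] n) x \<in> U" for n :: nat
    proof -
      have "x \<in> A n" using x by blast
      then obtain d where d: "d \<in> P" "x = cj (h [^] n) d" unfolding A_def by blast
      then have "cj (inv h [^] n) x = d" using h Pc by auto
      then show ?thesis using d(1) minus_part_subset unfolding P_def by blast
    qed
    then have "x \<in> minus_part (inv h) U" using xP Pc by (auto simp: minus_part_def)
    then show "x \<in> W" using xP W(2) unfolding P_def by blast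
  qed
  ultimately obtain N where N: "A N \<subseteq> W"
    using compactin_nested_subset[of T A W] Hausdorff mono W(1) by blast
  have "A n \<subseteq> A N" if "n \<ge> N" for n
    using lift_Suc_antimono_le[of A, OF mono that] .
  moreover have "cj (h [^] n) s \<in> A n" for n :: nat using s unfolding A_def P_def by blast
  ultimately show "\<forall>\<^sub>F n in sequentially. cj (h [^] n) s \<in> W"
    unfolding eventually_sequentially using N by blast
qed

text \<open>Shadowing for \<open>F n = f [^] n\<close> gives \<open>s \<in> U\<^sub>+\<close>, which
  \<open>inv g\<close> attracts to the core \<open>Q\<close>. A factor \<open>q \<in> Q\<close>
  moves it into \<open>con G T (inv g)\<close>, and the shadowing relation survives because the
  orbit of \<open>q\<close> under \<open>g\<close> stays in \<open>U\<close>.\<close>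

lemma perturbation_shadow:
  assumes U: "compact_open_subgroup U" and tidy: "tidy_above g U" and g: "g \<in> carrier G"
    and uv: "u \<in> U" "v \<in> U" and f: "f = u \<otimes> g \<otimes> v"
  obtains s where "s \<in> minus_part (inv g) U" "s \<in> con G T (inv g)"
    "\<And>n::nat. f [^] n \<otimes> s \<otimes> inv (g [^] n) \<in> U"
proof -
  note UD = compact_open_subgroupD[OF U]
  have fc: "f \<in> carrier G" using f uv g UD(6) by auto
  have h: "inv g \<in> carrier G" using g by simp
  have "\<exists>u\<in>U. \<exists>v\<in>U. f [^] Suc n = u \<otimes> g \<otimes> v \<otimes> f [^] n" for n :: nat
    using uv f nat_pow_Suc2[OF fc, of n] by metis
  then obtain s where s: "s \<in> minus_part (inv g) U" "\<And>n::nat. f [^] n \<otimes> s \<otimes> inv (g [^] n) \<in> U"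
    using shadowing[OF UD(3,1) tidy g, of "\<lambda>n. f [^] n"] by auto
  define Q where "Q = minus_part (inv g) U \<inter> minus_part (inv (inv g)) U"
  have subP: "subgroup (minus_part (inv g) U) G" using UD(1) h by (rule subgroup_minus_part)
  have "stable_subgroup (inv g) Q"
    unfolding stable_subgroup_def
  proof (intro conjI ballI)
    show "subgroup Q G"
      unfolding Q_def using subP subgroup_minus_part[OF UD(1) g] g
      by (simp add: subgroups_Inter_pair)
    show "compactin T Q"
      unfolding Q_def using compactin_minus_part[OF UD(3)] g h
      by (intro closed_Int_compactin compactin_closedin) auto
    show "cj (inv g) x \<in> Q" "cj (inv (inv g)) x \<in> Q" if "x \<in> Q" for x
      using that cj_mem_core[of x "inv g" U] cj_mem_core[of x g U] g h unfolding Q_def by auto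
  qed
  moreover have sc: "s \<in> carrier G" using s(1) by (rule minus_part_carrier)
  moreover have "attracted (inv g) s Q" unfolding Q_def by (rule attracted_core[OF U h s(1)])
  ultimately obtain q where q: "q \<in> Q" "s \<otimes> q \<in> con G T (inv g)"
    using attracted_imp_con[OF _ h] by blast
  have qc: "q \<in> carrier G" using q(1) minus_part_carrier unfolding Q_def by blast
  have "f [^] n \<otimes> (s \<otimes> q) \<otimes> inv (g [^] n) \<in> U" for n :: nat
  proof -
    have "f [^] n \<otimes> (s \<otimes> q) \<otimes> inv (g [^] n) = (f [^] n \<otimes> s \<otimes> inv (g [^] n)) \<otimes> cj (g [^] n) q"
      using fc sc qc g by (simp add: cj_def m_assoc)
    moreover have "cj (g [^] n) q \<in> U"
      using q(1) minus_partD[of q g U n] g unfolding Q_def by simp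
    ultimately show ?thesis using s(2) UD(1) by (simp add: subgroup.m_closed)
  qed
  moreover have "s \<otimes> q \<in> minus_part (inv g) U"
    using s(1) q(1) subP unfolding Q_def by (simp add: subgroup.m_closed)
  ultimately show thesis using that q(2) by blast
qed

lemma cj_minus_part_of_shadow:
  assumes U: "compact_open_subgroup U" and c: "f \<in> carrier G" "g \<in> carrier G" "s \<in> carrier G"
    and b: "\<And>n::nat. f [^] n \<otimes> s \<otimes> inv (g [^] n) \<in> U" and m: "m \<in> minus_part g U"
  shows "cj s m \<in> minus_part f U"
proof -
  have mc: "m \<in> carrier G" using m by (rule minus_part_carrier)
  have "cj (f [^] n) (cj s m) \<in> U" for n :: nat
  proof -
    let ?b = "f [^] n \<otimes> s \<otimes> inv (g [^] n)"
    have "cj (f [^] n) (cj s m) = ?b \<otimes> cj (g [^] n) m \<otimes> inv ?b"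
      using c mc by (simp add: cj_def m_assoc inv_mult_group)
    then show ?thesis
      using b[of n] minus_partD[OF m, of n] compact_open_subgroupD(1)[OF U]
      by (simp add: subgroup.m_closed subgroup.m_inv_closed)
  qed
  then show ?thesis using c mc by (simp add: minus_part_def)
qed

text \<open>The symmetries of the situation: \<open>inv f\<close> is a perturbation of
  \<open>inv g\<close>, and \<open>g\<close> one of \<open>f\<close>, within the same
  \<open>U\<close>.\<close>

lemma perturbation_inv:
  assumes "compact_open_subgroup U" "g \<in> carrier G" "u \<in> U" "v \<in> U" "f = u \<otimes> g \<otimes> v"
  shows "inv v \<in> U" "inv u \<in> U" "inv f = inv v \<otimes> inv g \<otimes> inv u" "g = inv u \<otimes> f \<otimes> inv v"
proof -
  have c: "u \<in> carrier G" "v \<in> carrier G" using assms compact_open_subgroupD(6) by blast+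
  show "inv v \<in> U" "inv u \<in> U" using assms compact_open_subgroupD(1)
    by (auto intro: subgroup.m_inv_closed)
  show "inv f = inv v \<otimes> inv g \<otimes> inv u" "g = inv u \<otimes> f \<otimes> inv v"
    using assms(2,5) c by (simp_all add: m_assoc inv_mult_group)
qed

text \<open>Shadows \<open>s\<close> of \<open>g\<close> and \<open>r\<close> of
  \<open>inv g\<close> carry \<open>U\<^sub>-\<close> and \<open>U\<^sub>+\<close> for
  \<open>g\<close> into those for \<open>f\<close>. One needs \<open>p\<close>, \<open>m\<close>
  with \<open>x = cj r p \<otimes> cj s m\<close>, that is, with \<open>inv r \<otimes> x \<otimes>
  s = p \<otimes> (inv r \<otimes> s) \<otimes> m\<close>. Factoring both
  \<open>inv r \<otimes> x \<otimes> s\<close> and \<open>inv r \<otimes> s\<close> by tidiness for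
  \<open>g\<close> provides them.\<close>

lemma perturbation_tidy_above:
  assumes U: "compact_open_subgroup U" and tidy: "tidy_above g U" and g: "g \<in> carrier G"
    and uv: "u \<in> U" "v \<in> U" and f: "f = u \<otimes> g \<otimes> v"
  shows "tidy_above f U"
  unfolding tidy_above_def
proof
  note UD = compact_open_subgroupD[OF U] and inv = perturbation_inv[OF U g uv f]
  have fc: "f \<in> carrier G" using f uv g UD(6) by auto
  have h: "inv g \<in> carrier G" using g by simp
  obtain s where s: "s \<in> minus_part (inv g) U" "\<And>n::nat. f [^] n \<otimes> s \<otimes> inv (g [^] n) \<in> U"
    using perturbation_shadow[OF U tidy g uv f] by blast
  obtain r where r: "r \<in> minus_part (inv (inv g)) U"
    "\<And>n::nat. inv f [^] n \<otimes> r \<otimes> inv (inv g [^] n) \<in> U"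
    using perturbation_shadow[OF U tidy_above_inv[OF tidy UD(1) g] h inv(1,2,3)] by blast
  have c: "s \<in> carrier G" "r \<in> carrier G" using s(1) r(1) by (auto intro: minus_part_carrier)
  have rU: "r \<in> U" and sU: "s \<in> U" using s(1) r(1) minus_part_subset by blast+
  have factor: "\<exists>a\<in>minus_part (inv g) U. \<exists>b\<in>minus_part g U. x = a \<otimes> b" if "x \<in> U" for x
    using tidy that unfolding tidy_above_def by blast
  fix x assume x: "x \<in> U"
  have "inv r \<otimes> s \<in> U" "inv r \<otimes> x \<otimes> s \<in> U"
    using rU sU x UD(1) by (auto intro: subgroup.m_closed subgroup.m_inv_closed)
  then obtain p0 m0 p1 m1 where
    0: "p0 \<in> minus_part (inv g) U" "m0 \<in> minus_part g U" "inv r \<otimes> s = p0 \<otimes> m0" and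
    1: "p1 \<in> minus_part (inv g) U" "m1 \<in> minus_part g U" "inv r \<otimes> x \<otimes> s = p1 \<otimes> m1"
    using factor by metis
  have pc: "p0 \<in> carrier G" "m0 \<in> carrier G" "p1 \<in> carrier G" "m1 \<in> carrier G"
    using 0 1 by (auto intro: minus_part_carrier)
  have xc: "x \<in> carrier G" using x UD(6) by blast
  let ?p = "p1 \<otimes> inv p0" and ?m = "inv m0 \<otimes> m1"
  have "?p \<in> minus_part (inv g) U" "?m \<in> minus_part g U"
    using 0 1 subgroup_minus_part[OF UD(1)] g h
    by (auto intro: subgroup.m_closed subgroup.m_inv_closed)
  then have "cj r ?p \<in> minus_part (inv f) U" "cj s ?m \<in> minus_part f U"
    using cj_minus_part_of_shadow[OF U _ _ _ s(2)] cj_minus_part_of_shadow[OF U _ _ _ r(2)] c fc g h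
    by auto
  moreover have "x = cj r ?p \<otimes> cj s ?m"
  proof -
    have "x = r \<otimes> (inv r \<otimes> x \<otimes> s) \<otimes> inv s" using xc c by (simp add: m_assoc)
    also have "\<dots> = r \<otimes> (?p \<otimes> (p0 \<otimes> m0) \<otimes> ?m) \<otimes> inv s"
      unfolding 1(3) using pc c by (simp add: m_assoc)
    also have "\<dots> = cj r ?p \<otimes> cj s ?m"
      unfolding 0(3)[symmetric] using pc c by (simp add: m_assoc cj_def)
    finally show ?thesis .
  qed
  ultimately show "\<exists>a\<in>minus_part (inv f) U. \<exists>b\<in>minus_part f U. x = a \<otimes> b" by blast
qed

lemma perturbation_con:
  assumes U: "compact_open_subgroup U" and tidy: "tidy_above g U" and g: "g \<in> carrier G"
    and uv: "u \<in> U" "v \<in> U" and f: "f = u \<otimes> g \<otimes> v"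
  obtains s r where "s \<in> con G T (inv g)" "con G T f = cj s ` con G T g"
    "r \<in> con G T g" "con G T (inv f) = cj r ` con G T (inv g)"
proof -
  note UD = compact_open_subgroupD[OF U] and inv = perturbation_inv[OF U g uv f]
  have fc: "f \<in> carrier G" using f uv g UD(6) by auto
  have h: "inv g \<in> carrier G" using g by simp
  obtain s where s: "s \<in> con G T (inv g)" "\<And>n::nat. f [^] n \<otimes> s \<otimes> inv (g [^] n) \<in> U"
    using perturbation_shadow[OF U tidy g uv f] by blast
  obtain r where r: "r \<in> con G T (inv (inv g))"
    "\<And>n::nat. inv f [^] n \<otimes> r \<otimes> inv (inv g [^] n) \<in> U"
    using perturbation_shadow[OF U tidy_above_inv[OF tidy UD(1) g] h inv(1,2,3)] by blast
  have c: "s \<in> carrier G" "r \<in> carrier G" using s(1) r(1) con_carrier by blast+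
  show thesis
    using that[OF s(1) con_of_shadow[OF U fc g c(1) s(2)] _
        con_of_shadow[OF U inv_closed[OF fc] h c(2) r(2)]] r(1) g by simp
qed

section \<open>Tits cores of single elements\<close>

lemma tits_core_single:
  "tits_core G T {g} = generate G (T closure_of con G T g \<union> T closure_of con G T (inv g))"
  by (simp add: tits_core_def SET_INV_def Un_commute)

lemma closure_of_con_carrier: "T closure_of con G T g \<subseteq> carrier G"
  using closure_of_subset_topspace topspace_eq by metis

lemma subgroup_tits_core: "subgroup (tits_core G T {g}) G"
  unfolding tits_core_single by (intro generate_is_subgroup) (use closure_of_con_carrier in auto)

lemma closure_of_con_subset_tits_core:
  "T closure_of con G T g \<subseteq> tits_core G T {g}" "T closure_of con G T (inv g) \<subseteq> tits_core G T {g}"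
  unfolding tits_core_single by (auto intro: generate.incl)

lemma con_subset_tits_core:
  "con G T g \<subseteq> tits_core G T {g}" "con G T (inv g) \<subseteq> tits_core G T {g}"
  using closure_of_con_subset_tits_core closure_of_subset[of "con G T _" T] con_carrier topspace_eq
  by blast+

lemma tits_core_least:
  assumes "subgroup S G" "T closure_of con G T g \<subseteq> S" "T closure_of con G T (inv g) \<subseteq> S"
  shows "tits_core G T {g} \<subseteq> S"
  unfolding tits_core_single using assms by (intro generate_subgroup_incl) auto

lemma homeomorphic_map_cj: "a \<in> carrier G \<Longrightarrow> homeomorphic_map T T (cj a)"
  unfolding homeomorphic_map_maps homeomorphic_maps_def
  by (rule exI[of _ "cj (inv a)"]) (auto simp: continuous_map_cj topspace_eq)

lemma closure_of_cj_image:
  "\<lbrakk>a \<in> carrier G; A \<subseteq> carrier G\<rbrakk> \<Longrightarrow> T closure_of (cj a ` A) = cj a ` (T closure_of A)"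
  using homeomorphic_map_closure_of[OF homeomorphic_map_cj] topspace_eq by blast

lemma subgroup_cj_image:
  assumes "subgroup S G" "a \<in> carrier G"
  shows "subgroup (cj a ` S) G"
  using cj_vimage_eq_image[of "inv a" S] subgroup_cj_vimage[of S "inv a"] assms subgroup.subset
  by fastforce

lemma tits_core_cj:
  assumes "a \<in> carrier G" "g \<in> carrier G"
  shows "tits_core G T {cj a g} = cj a ` tits_core G T {g}"
proof -
  have sub: "tits_core G T {cj b k} \<subseteq> cj b ` tits_core G T {k}"
    if b: "b \<in> carrier G" and k: "k \<in> carrier G" for b k
  proof (rule tits_core_least)
    show "subgroup (cj b ` tits_core G T {k}) G"
      using subgroup_tits_core b by (rule subgroup_cj_image)
    show "T closure_of con G T (cj b k) \<subseteq> cj b ` tits_core G T {k}"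
      unfolding con_cj[OF b k] closure_of_cj_image[OF b con_carrier]
      using closure_of_con_subset_tits_core by blast
    show "T closure_of con G T (inv (cj b k)) \<subseteq> cj b ` tits_core G T {k}"
      unfolding cj_inv[OF b k, symmetric] con_cj[OF b inv_closed[OF k]] closure_of_cj_image[OF b con_carrier]
      using closure_of_con_subset_tits_core by blast
  qed
  have "cj a ` tits_core G T {g} \<subseteq> tits_core G T {cj a g}"
  proof
    fix x assume "x \<in> cj a ` tits_core G T {g}"
    then obtain y where y: "y \<in> tits_core G T {g}" "x = cj a y" by blast
    have "tits_core G T {g} \<subseteq> cj (inv a) ` tits_core G T {cj a g}"
      using sub[of "inv a" "cj a g"] assms by simp
    then obtain z where z: "z \<in> tits_core G T {cj a g}" "y = cj (inv a) z" using y(1) by blast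
    have "z \<in> carrier G" using z(1) subgroup.subset[OF subgroup_tits_core] by blast
    then show "x \<in> tits_core G T {cj a g}" using y z assms by simp
  qed
  then show ?thesis using sub[OF assms] by blast
qed

text \<open>The conjugators \<open>s\<close> and \<open>r\<close> lie in the contraction groups of
  \<open>inv g\<close> and \<open>g\<close>, hence in the Tits core of \<open>g\<close>. Conjugation
  commutes with closure, so the generators for \<open>f\<close> are conjugates, by elements of that
  core, of sets inside it.\<close>

lemma perturbation_tits_core_subset:
  assumes U: "compact_open_subgroup U" and tidy: "tidy_above g U" and g: "g \<in> carrier G"
    and uv: "u \<in> U" "v \<in> U" and f: "f = u \<otimes> g \<otimes> v"
  shows "tits_core G T {f} \<subseteq> tits_core G T {g}"
proof -
  obtain s r where sr: "s \<in> con G T (inv g)" "con G T f = cj s ` con G T g"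
    "r \<in> con G T g" "con G T (inv f) = cj r ` con G T (inv g)"
    using perturbation_con[OF assms] by blast
  have c: "s \<in> carrier G" "r \<in> carrier G" using sr con_carrier by blast+
  have closed:
    "cj t x \<in> tits_core G T {g}" if "t \<in> tits_core G T {g}" "x \<in> tits_core G T {g}" for t x
    unfolding cj_def using that subgroup_tits_core
    by (auto intro: subgroup.m_closed subgroup.m_inv_closed)
  have t: "s \<in> tits_core G T {g}" "r \<in> tits_core G T {g}"
    using sr con_subset_tits_core by blast+
  show ?thesis
  proof (rule tits_core_least[OF subgroup_tits_core])
    show "T closure_of con G T f \<subseteq> tits_core G T {g}"
      unfolding sr(2) closure_of_cj_image[OF c(1) con_carrier]
      using closed[OF t(1)] closure_of_con_subset_tits_core(1) by blast
    show "T closure_of con G T (inv f) \<subseteq> tits_core G T {g}"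
      unfolding sr(4) closure_of_cj_image[OF c(2) con_carrier]
      using closed[OF t(2)] closure_of_con_subset_tits_core(2) by blast
  qed
qed

lemma perturbation_tits_core:
  assumes U: "compact_open_subgroup U" and tidy: "tidy_above g U" and g: "g \<in> carrier G"
    and uv: "u \<in> U" "v \<in> U" and f: "f = u \<otimes> g \<otimes> v"
  shows "tits_core G T {f} = tits_core G T {g}"
proof
  note inv = perturbation_inv[OF U g uv f]
  have fc: "f \<in> carrier G" using f uv g compact_open_subgroupD(6)[OF U] by auto
  show "tits_core G T {f} \<subseteq> tits_core G T {g}"
    by (rule perturbation_tits_core_subset[OF assms])
  show "tits_core G T {g} \<subseteq> tits_core G T {f}"
    by (rule perturbation_tits_core_subset[OF U perturbation_tidy_above[OF assms] fc inv(2,1,4)])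
qed

lemma tits_core_pow:
  fixes n :: nat
  assumes "g \<in> carrier G" "n > 0"
  shows "tits_core G T {g [^] n} = tits_core G T {g}"
  using con_pow[of g n] con_pow[of "inv g" n] assms
  by (simp add: tits_core_single nat_pow_inv)

text \<open>The perturbation results apply to \<open>cj y k\<close> and \<open>h [^] n\<close>. As
  \<open>y\<close> commutes with \<open>h\<close>, conjugation by \<open>y\<close> preserves both
  \<open>con G T h\<close> and its Tits core, so the conclusion passes to \<open>k\<close> with
  \<open>t = cj (inv y) (inv s)\<close>.\<close>

lemma con_conjugate_of_recurrence:
  fixes n :: nat
  assumes U: "compact_open_subgroup U" and tidy: "tidy_above h U"
  and c: "h \<in> carrier G" "k \<in> carrier G" "y \<in> carrier G"
    and y: "cj y h = h" and n: "n > 0"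
    and uv: "u \<in> U" "v \<in> U" and k: "cj y k = u \<otimes> h [^] n \<otimes> v"
  shows "tits_core G T {k} = tits_core G T {h}"
    and "\<exists>t\<in>tits_core G T {k}. con G T h = cj t ` con G T k"
proof -
  define D where "D = tits_core G T {h}"
  note tidy' = tidy_above_pow[OF tidy c(1), of n]
  have g: "h [^] n \<in> carrier G" using c by simp
  have y': "inv y \<in> carrier G" "cj (inv y) h = h"
    using c y cj_inv_cancel(1)[of y h] by simp_all
  have D_y: "cj (inv y) ` D = D"
    unfolding D_def using tits_core_cj[OF y'(1) c(1)] y'(2) by simp
  have f: "tits_core G T {cj y k} = D"
    unfolding D_def using perturbation_tits_core[OF U tidy' g uv k] tits_core_pow[OF c(1) n] by simp
  have "tits_core G T {k} = tits_core G T {cj (inv y) (cj y k)}" using c by simp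
  also have "\<dots> = cj (inv y) ` D" by (simp only: tits_core_cj[OF y'(1) cj_closed[OF c(3,2)]] f)
  also have "\<dots> = tits_core G T {h}" by (simp only: D_y D_def[symmetric])
  finally show Dk: "tits_core G T {k} = tits_core G T {h}" .
  obtain s where s: "s \<in> con G T (inv (h [^] n))" "con G T (cj y k) = cj s ` con G T (h [^] n)"
    by (rule perturbation_con[OF U tidy' g uv k]) (rule that)
  have sD: "s \<in> D"
    using s(1) con_subset_tits_core(2)[of "h [^] n"] tits_core_pow[OF c(1) n] unfolding D_def
    by blast
  have sc: "s \<in> carrier G" using s(1) con_carrier by blast
  have "inv s \<in> D"
    using sD subgroup_tits_core unfolding D_def by (auto intro: subgroup.m_inv_closed)
  then have "cj (inv y) (inv s) \<in> D" using D_y by blast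
  moreover have "con G T h = cj (cj (inv y) (inv s)) ` con G T k"
  proof -
    have kc: "con G T (cj y k) = cj y ` con G T k" using con_cj c by simp
    have hc: "con G T h = cj (inv y) ` con G T h"
      using con_cj[OF y'(1) c(1)] y'(2) by simp
    have "(\<lambda>x. cj (inv s) (cj s x)) ` con G T h = (\<lambda>x. x) ` con G T h"
      using sc subsetD[OF con_carrier] by (intro image_cong) simp_all
    then have "cj (inv s) ` con G T (cj y k) = con G T h"
      unfolding s(2) con_pow[OF c(1) n] image_image by simp
    then have "con G T h = cj (inv y) ` cj (inv s) ` cj y ` con G T k"
      using hc kc by simp
    also have "\<dots> = cj (cj (inv y) (inv s)) ` con G T k"
      unfolding image_image using con_carrier[of k] c sc
      by (intro image_cong refl) (auto simp: cj_cj cj_def[of "inv y" "inv s"] m_assoc subset_iff)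
    finally show ?thesis .
  qed
  ultimately show "\<exists>t\<in>tits_core G T {k}. con G T h = cj t ` con G T k"
    unfolding Dk D_def by blast
qed

end

section \<open>Recurrence on the coset space\<close>

context tdlc_group
begin

lemma subgroup_closure_of:
  assumes "subgroup K G"
  shows "subgroup (T closure_of K) G"
proof -
  have Kc: "K \<subseteq> carrier G" using assms subgroup.subset by blast
  have Kcl: "K \<subseteq> T closure_of K" using closure_of_subset Kc topspace_eq by metis
  have sub: "T closure_of K \<subseteq> carrier G" using closure_of_subset_topspace topspace_eq by metis
  have inv: "inv x \<in> T closure_of K" if "x \<in> T closure_of K" for x
  proof -
    have "(\<lambda>x. inv x) ` (T closure_of K) \<subseteq> T closure_of ((\<lambda>x. inv x) ` K)"
      using continuous_inv by (rule continuous_map_image_closure_subset)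
    also have "\<dots> \<subseteq> T closure_of K"
      using assms by (intro closure_of_mono) (auto intro: subgroup.m_inv_closed)
    finally show ?thesis using that by blast
  qed
  have mult: "x \<otimes> y \<in> T closure_of K" if "x \<in> T closure_of K" "y \<in> T closure_of K" for x y
  proof -
    have "(\<lambda>(x, y). x \<otimes> y) ` ((prod_topology T T) closure_of (K \<times> K))
        \<subseteq> T closure_of ((\<lambda>(x, y). x \<otimes> y) ` (K \<times> K))"
      using continuous_mult by (rule continuous_map_image_closure_subset)
    also have "\<dots> \<subseteq> T closure_of K"
      using assms by (intro closure_of_mono) (auto intro: subgroup.m_closed)
    finally have "(\<lambda>(x, y). x \<otimes> y) ` ((T closure_of K) \<times> (T closure_of K)) \<subseteq> T closure_of K"
      by (simp add: closure_of_Times)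
    then show ?thesis using that by auto
  qed
  have "T closure_of K \<noteq> {}" using Kcl subgroup.one_closed[OF assms] by blast
  then show ?thesis using sub inv mult by (intro subgroupI)
qed

end

section \<open>The coset space \<open>H/L\<close> and orbits of compact open subgroups on it\<close>

locale subgroup_pair = tdlc_group +
  fixes H L :: "'a set"
  assumes subgroup_H: "subgroup H G" and subgroup_L: "subgroup L G" and L_subset_H: "L \<subseteq> H"
begin

lemma H_carrier: "H \<subseteq> carrier G" and L_carrier: "L \<subseteq> carrier G"
  using subgroup_H subgroup_L subgroup.subset by blast+

definition orbit :: "'a set \<Rightarrow> 'a \<Rightarrow> 'a set set" where
  "orbit U y = (\<lambda>u. (u \<otimes> y) <# L) ` (U \<inter> H)"

lemma orbit_subset: "y \<in> H \<Longrightarrow> orbit U y \<subseteq> coset_space G H L"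
  unfolding orbit_def coset_space_def using subgroup_H by (auto intro: subgroup.m_closed)

lemma coset_mem_orbit: "\<lbrakk>compact_open_subgroup U; y \<in> H\<rbrakk> \<Longrightarrow> y <# L \<in> orbit U y"
  unfolding orbit_def
  using subgroup.one_closed[OF subgroup_H] compact_open_subgroupD(5)[of U] H_carrier
  by (intro image_eqI[of _ _ \<one>]) auto

text \<open>The preimage of the orbit in \<open>H\<close> contains with each \<open>x\<close> all
  \<open>z \<in> H\<close> such that \<open>z \<otimes> inv x \<in> U\<close>, because
  \<open>z L\<close> is the translate of \<open>x L\<close> by
  \<open>z \<otimes> inv x\<close>.\<close>

lemma openin_orbit:
  assumes U: "compact_open_subgroup U" and y: "y \<in> H"
  shows "openin (coset_topology G T H L) (orbit U y)"
  unfolding openin_coset_topology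
proof
  show "orbit U y \<subseteq> coset_space G H L" using y by (rule orbit_subset)
  define S where "S = {x \<in> H. x <# L \<in> orbit U y}"
  have mem: "z <# L \<in> orbit U y" if x: "x \<in> S" and z: "z \<in> H" "z \<otimes> inv x \<in> U" for x z
  proof -
    obtain u where u: "u \<in> U" "u \<in> H" "x <# L = (u \<otimes> y) <# L" using x unfolding S_def orbit_def
      by blast
    have c: "x \<in> carrier G" "z \<in> carrier G" "u \<in> carrier G" "y \<in> carrier G"
      using x z u y H_carrier unfolding S_def by blast+
    have "z <# L = (z \<otimes> inv x) <# (x <# L)"
      using c L_carrier by (simp add: lcos_m_assoc m_assoc)
    also have "\<dots> = ((z \<otimes> inv x \<otimes> u) \<otimes> y) <# L"
      unfolding u(3) using c L_carrier by (simp add: lcos_m_assoc m_assoc)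
    finally have "z <# L = ((z \<otimes> inv x \<otimes> u) \<otimes> y) <# L" .
    moreover have "z \<otimes> inv x \<otimes> u \<in> U" using z(2) u(1) compact_open_subgroupD(1)[OF U]
      by (simp add: subgroup.m_closed)
    moreover have "z \<otimes> inv x \<otimes> u \<in> H"
      using z(1) u(2) x subgroup_H unfolding S_def
      by (auto intro: subgroup.m_closed subgroup.m_inv_closed)
    ultimately show ?thesis unfolding orbit_def by blast
  qed
  have "S = (\<Union>x\<in>S. {z \<in> carrier G. z \<otimes> inv x \<in> U}) \<inter> H" (is "_ = ?V \<inter> H")
  proof
    show "S \<subseteq> ?V \<inter> H"
    proof
      fix x assume x: "x \<in> S"
      then have "x \<in> H" "x \<in> carrier G" "x \<otimes> inv x \<in> U"
        using H_carrier compact_open_subgroupD(5)[OF U] unfolding S_def by auto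
      then show "x \<in> ?V \<inter> H" using x by blast
    qed
    show "?V \<inter> H \<subseteq> S"
    proof
      fix z assume z: "z \<in> ?V \<inter> H"
      then obtain x where "x \<in> S" "z \<otimes> inv x \<in> U" by blast
      then show "z \<in> S" using mem[of x z] z unfolding S_def by simp
    qed
  qed
  moreover have "openin T {z \<in> carrier G. z \<otimes> inv x \<in> U}" if "x \<in> S" for x
    using that H_carrier compact_open_subgroupD(2)[OF U] unfolding S_def
    by (intro openin_r_mult_vimage) auto
  then have "openin T (\<Union>x\<in>S. {z \<in> carrier G. z \<otimes> inv x \<in> U})" by blast
  ultimately have "openin (subtopology T H) S"
    unfolding openin_subtopology by blast
  then show "openin (subtopology T H) {x \<in> H. x <# L \<in> orbit U y}"
    unfolding S_def .
qed

text \<open>Translating by \<open>y\<close> conjugates the acting group by \<open>y\<close>.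
  Translates of orbits are thus orbits of compact open subgroups, hence open.\<close>

lemma translate_orbit:
  assumes U: "compact_open_subgroup U" and y: "y \<in> H"
  shows "(\<lambda>c. y <# c) ` orbit U \<one> = orbit {x \<in> carrier G. cj (inv y) x \<in> U} y"
proof -
  have yc: "y \<in> carrier G" using y H_carrier by blast
  have Uc: "U \<subseteq> carrier G" using compact_open_subgroupD(6)[OF U] .
  have eq: "y <# ((u \<otimes> \<one>) <# L) = (cj y u \<otimes> y) <# L" if "u \<in> U" for u
    using that Uc yc L_carrier by (simp add: lcos_m_assoc cj_def m_assoc subset_iff)
  have H_cj: "cj a u \<in> H" if "u \<in> H" "a \<in> H" for a u
    using that subgroup_H unfolding cj_def by (auto intro: subgroup.m_closed subgroup.m_inv_closed)
  have "cj y ` (U \<inter> H) = {x \<in> carrier G. cj (inv y) x \<in> U} \<inter> H" (is "?l = ?r")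
  proof
    show "?l \<subseteq> ?r" using Uc yc H_cj y by auto
    show "?r \<subseteq> ?l"
    proof
      fix x assume x: "x \<in> ?r"
      then have "cj (inv y) x \<in> U \<inter> H"
        using H_cj y subgroup.m_inv_closed[OF subgroup_H] by blast
      moreover have "x = cj y (cj (inv y) x)" using x yc by simp
      ultimately show "x \<in> ?l" by blast
    qed
  qed
  then have "orbit {x \<in> carrier G. cj (inv y) x \<in> U} y = (\<lambda>u. (u \<otimes> y) <# L) ` (cj y ` (U \<inter> H))"
    unfolding orbit_def by (rule arg_cong[OF sym])
  also have "\<dots> = (\<lambda>u. (cj y u \<otimes> y) <# L) ` (U \<inter> H)" by (rule image_image)
  also have "\<dots> = (\<lambda>c. y <# c) ` orbit U \<one>"
    unfolding orbit_def image_image using eq by (intro image_cong) auto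
  finally show ?thesis by simp
qed

lemma coset_eqD:
  assumes "x <# L = z <# L" "x \<in> carrier G" "z \<in> carrier G"
  obtains l where "l \<in> L" "z = x \<otimes> l"
proof -
  have "z \<otimes> \<one> \<in> z <# L" using subgroup.one_closed[OF subgroup_L] unfolding l_coset_def by blast
  then have "z \<in> x <# L" using assms by simp
  then show thesis using that unfolding l_coset_def by blast
qed

definition recurrent :: "'a set \<Rightarrow> 'a \<Rightarrow> bool" where
  "recurrent U h \<longleftrightarrow> (\<exists>(i::nat) (n::nat). n > 0 \<and>
     (\<exists>l\<in>L. \<exists>u\<in>U. \<exists>v\<in>U. cj (h [^] i) l = u \<otimes> h [^] n \<otimes> v))"

lemma H_pow: "h \<in> H \<Longrightarrow> h [^] (n::nat) \<in> H"
  using subgroup_H by (induction n) (auto intro: subgroup.m_closed subgroup.one_closed)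

text \<open>Finitely many \<open>U\<close>-orbits cover \<open>H/L\<close>, so by the pigeonhole
  principle two of the cosets \<open>h [^] i L\<close> share an orbit. Solving for the element of
  \<open>L\<close> gives the recurrence with \<open>v = \<one>\<close>.\<close>

lemma cocompact_recurrent:
  assumes U: "compact_open_subgroup U" and h: "h \<in> H" and compact: "cocompact G T H L"
  shows "recurrent U h"
proof -
  note UD = compact_open_subgroupD[OF U]
  have hc: "h \<in> carrier G" using h H_carrier by blast
  have top: "topspace (coset_topology G T H L) = coset_space G H L"
    using H_carrier topspace_eq by (intro topspace_coset_topology) simp
  have cover: "topspace (coset_topology G T H L) \<subseteq> \<Union>(orbit U ` H)"
    unfolding top coset_space_def using coset_mem_orbit[OF U] by blast
  obtain F where F: "finite F" "F \<subseteq> orbit U ` H" "topspace (coset_topology G T H L) \<subseteq> \<Union>F"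
    using compact[unfolded cocompact_def compact_space_alt, rule_format, of "orbit U ` H"]
      openin_orbit[OF U] cover by blast
  obtain Y where Y: "finite Y" "Y \<subseteq> H" "F = orbit U ` Y"
    using finite_subset_image[OF F(1,2)] by blast
  have "\<exists>y\<in>Y. h [^] i <# L \<in> orbit U y" for i :: nat
    using F(3) Y(3) H_pow[OF h, of i] unfolding top coset_space_def by blast
  then obtain y where y: "\<And>i::nat. y i \<in> Y" "\<And>i::nat. h [^] i <# L \<in> orbit U (y i)" by metis
  have "finite (range y)" using Y(1) y(1) by (meson finite_subset image_subsetI)
  then have "\<not> inj y" using range_inj_infinite by blast
  then obtain i j where ij: "i < j" "y i = y j"
    unfolding inj_def by (metis linorder_neqE_nat)
  define n where "n = j - i"
  obtain u where u: "u \<in> U" "h [^] i <# L = (u \<otimes> y i) <# L" using y(2)[of i] unfolding orbit_def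
    by blast
  obtain v where v: "v \<in> U" "h [^] j <# L = (v \<otimes> y i) <# L" using y(2)[of j] ij(2) unfolding orbit_def
    by auto
  have c: "u \<in> carrier G" "v \<in> carrier G" "y i \<in> carrier G" "h [^] i \<in> carrier G" "h [^] j \<in> carrier G"
    using u(1) v(1) UD(6) y(1)[of i] Y(2) H_carrier hc by auto
  have translate: "(inv w \<otimes> x) <# L = y i <# L"
    if "x <# L = (w \<otimes> y i) <# L" "w \<in> carrier G" "x \<in> carrier G" for w x
  proof -
    have "(inv w \<otimes> x) <# L = inv w <# (x <# L)" using that(2,3) L_carrier
      by (simp add: lcos_m_assoc)
    also have "\<dots> = y i <# L" unfolding that(1) using that(2) c L_carrier by (simp add: lcos_m_assoc)
    finally show ?thesis .
  qed
  have "(inv u \<otimes> h [^] i) <# L = (inv v \<otimes> h [^] j) <# L"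
    using translate[OF u(2)] translate[OF v(2)] c by simp
  then obtain l where l: "l \<in> L" "inv v \<otimes> h [^] j = inv u \<otimes> h [^] i \<otimes> l"
    using coset_eqD[of "inv u \<otimes> h [^] i" "inv v \<otimes> h [^] j"] c by auto
  have lc: "l \<in> carrier G" using l(1) L_carrier by blast
  have pow: "h [^] j = h [^] n \<otimes> h [^] i" using ij(1) hc by (simp add: nat_pow_mult n_def)
  have "cj (h [^] i) l = u \<otimes> (inv u \<otimes> h [^] i \<otimes> l) \<otimes> inv (h [^] i)"
    using c lc by (simp add: cj_def m_assoc)
  also have "\<dots> = (u \<otimes> inv v) \<otimes> h [^] n \<otimes> \<one>"
    unfolding l(2)[symmetric] pow using c hc by (simp add: m_assoc)
  finally have "cj (h [^] i) l = (u \<otimes> inv v) \<otimes> h [^] n \<otimes> \<one>" .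
  moreover have "u \<otimes> inv v \<in> U"
    using u(1) v(1) UD(1) by (simp add: subgroup.m_closed subgroup.m_inv_closed)
  moreover have "n > 0" using ij(1) by (simp add: n_def)
  ultimately show ?thesis
    unfolding recurrent_def using l(1) UD(5) by blast
qed

text \<open>Poincare recurrence: the translates of one open orbit by the powers of \<open>h\<close>
  have equal positive measure, so they cannot be pairwise disjoint in a probability space.\<close>

lemma finite_covolume_recurrent:
  assumes U: "compact_open_subgroup U" and h: "h \<in> H" and cov: "finite_covolume G T H L"
  shows "recurrent U h"
proof (rule ccontr)
  assume neg: "\<not> recurrent U h"
  note UD = compact_open_subgroupD[OF U]
  have hc: "h \<in> carrier G" using h H_carrier by blast
  obtain \<mu> :: "'a set measure" where prob: "prob_space \<mu>"
    and space: "space \<mu> = coset_space G H L"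
    and sets: "sets \<mu> = sigma_sets (coset_space G H L) {U. openin (coset_topology G T H L) U}"
    and inv: "\<And>y A. \<lbrakk>y \<in> H; A \<in> sets \<mu>\<rbrakk> \<Longrightarrow> emeasure \<mu> ((\<lambda>c. y <# c) ` A) = emeasure \<mu> A"
    and tight: "\<And>e. e > 0 \<Longrightarrow> \<exists>C. compactin (coset_topology G T H L) C \<and> measure \<mu> C > 1 - e"
    using cov unfolding finite_covolume_def by blast
  interpret prob_space \<mu> by (rule prob)
  define E where "E y = (\<lambda>c. y <# c) ` orbit U \<one>" for y
  have one: "\<one> \<in> H" using subgroup.one_closed[OF subgroup_H] .
  have openE: "openin (coset_topology G T H L) (E y)" if "y \<in> H" for y
    unfolding E_def translate_orbit[OF U that]
    using that H_carrier by (intro openin_orbit compact_open_subgroup_cj_vimage U) auto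
  have setsE: "E y \<in> sets \<mu>" if "y \<in> H" for y
    unfolding sets using openE[OF that] by (intro sigma_sets.Basic) simp
  have setsO: "orbit U \<one> \<in> sets \<mu>"
    unfolding sets using openin_orbit[OF U one] by (intro sigma_sets.Basic) simp
  define m where "m = measure \<mu> (orbit U \<one>)"
  have mE: "measure \<mu> (E y) = m" if "y \<in> H" for y
    unfolding E_def m_def measure_def using inv[OF that setsO] by simp
  \<comment> \<open>By tightness some compact \<open>C\<close> has positive measure. Finitely many
    translates of the orbit cover \<open>C\<close>, so they cannot all be null.\<close>
  have "m > 0"
  proof (rule ccontr)
    assume "\<not> m > 0"
    then have m0: "m = 0" using measure_nonneg[of \<mu> "orbit U \<one>"] unfolding m_def by linarith
    obtain C where C: "compactin (coset_topology G T H L) C" "measure \<mu> C > 1 - 1"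
      using tight[of 1] by auto
    have "C \<subseteq> coset_space G H L"
      using compactin_subset_topspace[OF C(1)] topspace_coset_topology[of H T G L] H_carrier topspace_eq
      by simp
    moreover have "y <# L \<in> E y" if "y \<in> H" for y
      unfolding E_def translate_orbit[OF U that]
      using that H_carrier by (intro coset_mem_orbit compact_open_subgroup_cj_vimage U) auto
    ultimately have "C \<subseteq> \<Union>(E ` H)" unfolding coset_space_def by blast
    then obtain F where F: "finite F" "F \<subseteq> E ` H" "C \<subseteq> \<Union>F"
      using C(1) openE unfolding compactin_def by (metis (no_types, lifting) imageE)
    obtain Y where Y: "finite Y" "Y \<subseteq> H" "F = E ` Y"
      using finite_subset_image[OF F(1,2)] by blast
    have sY: "E ` Y \<subseteq> sets \<mu>" using setsE Y(2) by blast
    then have "measure \<mu> C \<le> measure \<mu> (\<Union>y\<in>Y. E y)"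
      using F(3) Y by (intro finite_measure_mono sets.finite_UN) auto
    also have "\<dots> \<le> (\<Sum>y\<in>Y. measure \<mu> (E y))"
      using Y(1) sY by (rule finite_measure_subadditive_finite)
    also have "\<dots> = 0" using mE m0 Y(2) by (simp add: subset_iff)
    finally show False using C(2) by simp
  qed
  \<comment> \<open>An intersection point gives \<open>l \<in> L\<close> in
    \<open>U h [^] (j - i) U\<close>, which is recurrence with conjugating exponent 0.\<close>
  have disj: "E (h [^] i) \<inter> E (h [^] j) = {}" if ij: "i < j" for i j :: nat
  proof (rule ccontr)
    assume "E (h [^] i) \<inter> E (h [^] j) \<noteq> {}"
    then obtain u v where uv: "u \<in> U" "v \<in> U"
      "h [^] i <# ((u \<otimes> \<one>) <# L) = h [^] j <# ((v \<otimes> \<one>) <# L)"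
      unfolding E_def orbit_def by blast
    have c: "u \<in> carrier G" "v \<in> carrier G" using uv UD(6) by blast+
    have "(h [^] i \<otimes> u) <# L = (h [^] j \<otimes> v) <# L"
      using uv(3) c hc L_carrier by (simp add: lcos_m_assoc)
    then obtain l where l: "l \<in> L" "h [^] j \<otimes> v = h [^] i \<otimes> u \<otimes> l"
      using coset_eqD[of "h [^] i \<otimes> u" "h [^] j \<otimes> v"] c hc by auto
    have lc: "l \<in> carrier G" using l(1) L_carrier by blast
    have pow: "h [^] j = h [^] i \<otimes> h [^] (j - i)" using ij hc by (simp add: nat_pow_mult)
    have "l = inv u \<otimes> (inv (h [^] i) \<otimes> (h [^] i \<otimes> u \<otimes> l))" using c lc hc by (simp add: m_assoc)
    also have "\<dots> = inv u \<otimes> h [^] (j - i) \<otimes> v"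
      unfolding l(2)[symmetric] pow using c hc by (simp add: m_assoc)
    finally have "cj (h [^] (0::nat)) l = inv u \<otimes> h [^] (j - i) \<otimes> v" using lc by simp
    moreover have "inv u \<in> U" using uv(1) UD(1) by (simp add: subgroup.m_inv_closed)
    moreover have "j - i > 0" using ij by simp
    ultimately have "recurrent U h" unfolding recurrent_def using l(1) uv(2) by blast
    then show False using neg by simp
  qed
  obtain N where N: "1 < real N * m" using reals_Archimedean3[OF \<open>m > 0\<close>] by blast
  have "disjoint_family_on (\<lambda>i. E (h [^] i)) {..<N}"
    unfolding disjoint_family_on_def using disj by (metis Int_commute linorder_neqE_nat)
  moreover have "(\<lambda>i. E (h [^] i)) ` {..<N} \<subseteq> sets \<mu>" using setsE H_pow[OF h] by blast
  ultimately have "measure \<mu> (\<Union>i\<in>{..<N}. E (h [^] i)) = (\<Sum>i\<in>{..<N}. measure \<mu> (E (h [^] i)))"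
    by (intro finite_measure_finite_Union) auto
  also have "\<dots> = real N * m" using mE H_pow[OF h] by simp
  finally show False using N prob_le_1[of "\<Union>i\<in>{..<N}. E (h [^] i)"] by simp
qed

text \<open>Recurrence supplies a suitable element \<open>l\<close> of \<open>L\<close>. What is
  required of it is an open condition, so density lets an element of \<open>K\<close> take its
  place.\<close>

lemma con_conjugate_in_dense_subset:
  assumes h: "h \<in> H" and dense: "L = T closure_of K"
    and fin: "cocompact G T H L \<or> finite_covolume G T H L"
  shows "\<exists>k\<in>K. tits_core G T {k} = tits_core G T {h} \<and>
      (\<exists>t\<in>tits_core G T {k}. con G T h = cj t ` con G T k)"
proof -
  have hc: "h \<in> carrier G" using h H_carrier by blast
  have "openin T (carrier G)" using openin_topspace[of T] topspace_eq by simp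
  then obtain U0 where U0: "compact_open_subgroup U0" using van_dantzig[of "carrier G"] by blast
  obtain U where U: "compact_open_subgroup U" "tidy_above h (U \<inter> carrier G)"
  proof (rule exists_tidy_above[OF U0 subgroup_self _ hc])
    show "closedin T (carrier G)" using closedin_topspace[of T] topspace_eq by simp
  qed (use hc in auto)
  have tidy: "tidy_above h U" using U compact_open_subgroupD(6)[OF U(1)] by (simp add: Int_absorb2)
  have "recurrent U h"
    using fin cocompact_recurrent[OF U(1) h] finite_covolume_recurrent[OF U(1) h] by blast
  then obtain i n :: nat and l u v where n: "n > 0" and l: "l \<in> L" and uv: "u \<in> U" "v \<in> U"
    and eq: "cj (h [^] i) l = u \<otimes> h [^] n \<otimes> v"
    unfolding recurrent_def by blast
  define y where "y = h [^] i"
  define a where "a = u \<otimes> h [^] n"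
  have c: "u \<in> carrier G" "v \<in> carrier G" "l \<in> carrier G" "y \<in> carrier G" "a \<in> carrier G"
    using uv compact_open_subgroupD(6)[OF U(1)] l L_carrier hc by (auto simp: y_def a_def)
  \<comment> \<open>The left factor \<open>a\<close> is kept and only \<open>v\<close> may vary in
    \<open>U\<close>: \<open>W\<close> is the open set of \<open>x\<close> with
    \<open>cj y x \<in> a U\<close>.\<close>
  define W where "W = {x \<in> carrier G. cj y x \<in> {z \<in> carrier G. inv a \<otimes> z \<in> U}}"
  have "openin T W"
    unfolding W_def using c compact_open_subgroupD(2)[OF U(1)]
    by (intro openin_cj_vimage openin_l_mult_vimage) auto
  moreover have "l \<in> W"
    using eq c uv(2) unfolding W_def by (simp flip: y_def a_def)
  ultimately obtain k where k: "k \<in> K" "k \<in> W"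
    using l unfolding dense in_closure_of by blast
  have kc: "k \<in> carrier G" using k(2) by (simp add: W_def)
  have "cj y k = u \<otimes> h [^] n \<otimes> (inv a \<otimes> cj y k)"
    using c kc by (simp flip: a_def)
  moreover have "inv a \<otimes> cj y k \<in> U" using k(2) by (simp add: W_def)
  moreover have "cj y h = h"
  proof -
    have "y \<otimes> h = h \<otimes> y" using nat_pow_Suc2[OF hc, of i] by (simp add: y_def)
    then show ?thesis using c hc by (simp add: cj_def m_assoc)
  qed
  ultimately show ?thesis
    using con_conjugate_of_recurrence[OF U(1) tidy hc kc c(4) _ n uv(1)] k(1) by blast
qed

end

theorem theorem1p4:
  fixes G :: "('a, 'b) monoid_scheme" and T :: "'a topology" and H K :: "'a set"
  assumes "topological_group G T"
    and "totally_disconnected_space T"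
    and "locally_compact_space T"
    and "subgroup H G" and "closedin T H"
    and "subgroup K G" and "K \<subseteq> H"
    and "cocompact G T H (T closure_of K) \<or> finite_covolume G T H (T closure_of K)"
  shows "(\<forall>h \<in> H. \<exists>k \<in> K. \<exists>t \<in> tits_core G T {k}.
            con G T h = (t <#\<^bsub>G\<^esub> con G T k) #>\<^bsub>G\<^esub> inv\<^bsub>G\<^esub> t) \<and>
         {tits_core G T {h} | h. h \<in> H} = {tits_core G T {k} | k. k \<in> K} \<and>
         tits_core G T H = tits_core G T K"
proof -
  interpret tdlc_group G T
    using assms(1-3) by (simp add: tdlc_group_def tdlc_group_axioms_def)
  define L where "L = T closure_of K"
  \<comment> \<open>Closedness of \<open>H\<close> puts the closure of \<open>K\<close> inside
    \<open>H\<close>.\<close>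
  have LH: "L \<subseteq> H" unfolding L_def using assms(5,7) by (simp add: closure_of_minimal)
  interpret subgroup_pair G T H L
    using assms(4) subgroup_closure_of[OF assms(6)] LH
    by (intro subgroup_pair.intro subgroup_pair_axioms.intro tdlc_group_axioms) (simp_all add: L_def)
  have main: "\<exists>k\<in>K. tits_core G T {k} = tits_core G T {h} \<and>
      (\<exists>t\<in>tits_core G T {k}. con G T h = cj t ` con G T k)" if "h \<in> H" for h
    using con_conjugate_in_dense_subset[OF that] assms(8) unfolding L_def by blast
  have 1: "\<exists>k \<in> K. \<exists>t \<in> tits_core G T {k}.
      con G T h = (t <#\<^bsub>G\<^esub> con G T k) #>\<^bsub>G\<^esub> inv\<^bsub>G\<^esub> t" if h: "h \<in> H" for h
  proof -
    obtain k t where kt: "k \<in> K" "t \<in> tits_core G T {k}" "con G T h = cj t ` con G T k"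
      using main[OF h] by blast
    have "t \<in> carrier G" using kt(2) subgroup.subset[OF subgroup_tits_core] by blast
    then show ?thesis using kt l_coset_r_coset_eq_cj[OF con_carrier] by metis
  qed
  have 2: "{tits_core G T {h} | h. h \<in> H} = {tits_core G T {k} | k. k \<in> K}"
  proof
    show "{tits_core G T {h} | h. h \<in> H} \<subseteq> {tits_core G T {k} | k. k \<in> K}"
    proof
      fix A assume "A \<in> {tits_core G T {h} | h. h \<in> H}"
      then obtain h where h: "h \<in> H" "A = tits_core G T {h}" by blast
      obtain k where "k \<in> K" "tits_core G T {k} = tits_core G T {h}" using main[OF h(1)] by blast
      then show "A \<in> {tits_core G T {k} | k. k \<in> K}"
        unfolding h(2) by (intro CollectI exI[of _ k] conjI) simp_all
    qed
    show "{tits_core G T {k} | k. k \<in> K} \<subseteq> {tits_core G T {h} | h. h \<in> H}"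
      using assms(7) by blast
  qed
  have mono: "tits_core G T X \<subseteq> tits_core G T Y" if "X \<subseteq> Y" for X Y
    unfolding tits_core_def using that by (intro mono_generate) (auto simp: SET_INV_def)
  \<comment> \<open>Each generator on the left comes from some \<open>x \<in> H\<close>, since
    \<open>H\<close> is closed under inverses, and lies in the Tits core of \<open>x\<close>; this
    equals that of some \<open>k \<in> K\<close>.\<close>
  have "tits_core G T H \<subseteq> tits_core G T K"
    unfolding tits_core_def[of G T H]
  proof (rule generate_subgroup_incl)
    show "subgroup (tits_core G T K) G"
      unfolding tits_core_def by (intro generate_is_subgroup) (use closure_of_con_carrier in blast)
    show "(\<Union>x\<in>H \<union> set_inv\<^bsub>G\<^esub> H. T closure_of con G T x) \<subseteq> tits_core G T K"
    proof
      fix z assume "z \<in> (\<Union>x\<in>H \<union> set_inv\<^bsub>G\<^esub> H. T closure_of con G T x)"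
      then obtain x where x: "x \<in> H" "z \<in> T closure_of con G T x"
        using subgroup.m_inv_closed[OF assms(4)] by (auto simp: SET_INV_def)
      obtain k where "k \<in> K" "tits_core G T {k} = tits_core G T {x}" using main[OF x(1)] by blast
      then show "z \<in> tits_core G T K"
        using x(2) closure_of_con_subset_tits_core(1)[of x] mono[of "{k}" K] by blast
    qed
  qed
  then show ?thesis using 1 2 mono[OF assms(7)] by blast
qed

end
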